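(* Every countable group may be imbedded in a (finitely generated) group $G$ of non-uniform exponential growth. Furthermore, let $\alpha\approx 0.7674$ be the positive root of $2^{3-3/\alpha}+2^{2-2/\alpha}+2^{1-1/\alpha}=2$. Then $G$ may be required to have the following property: there is a constant $K$ such that, for any $R>0$, there exists a finite generating set $S$ of $G$ with \[\nu_{G,S}(r)\le\exp(K r^\alpha)\quad\text{for all } r\le R.\]
   Context: For a group $G$ generated by a finite set $S$, the growth function $\nu_{G,S}(R)$ is the number of elements in the ball of radius $R$ around the identity in the Cayley graph of $(G,S)$, i.e. the number of elements of $G$ expressible as a product of at most $R$ elements of $S\cup S^{-1}$. Set $\lambda_{G,S}=\lim_{R\to\infty}\sqrt[R]{\nu_{G,S}(R)}$. The group $G$ has exponential growth if $\lambda_{G,S}>1$ (for some, equivalently every, finite generating set $S$). It has uniform exponential growth if $\inf_S\lambda_{G,S}>1$, the infimum being over all finite generating sets $S$ of $G$. It has non-uniform exponential growth if it has exponential growth but not uniform exponential growth. *)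

theory Defs
  imports Complex_Main "HOL-Library.Countable_Set" "HOL-Algebra.Algebra"

begin

definition finite_generating_set :: "('a, 'b) monoid_scheme \<Rightarrow> 'a set \<Rightarrow> bool" where
  "finite_generating_set G S \<longleftrightarrow> finite S \<and> S \<subseteq> carrier G \<and> generate G S = carrier G"

definition finitely_generated :: "('a, 'b) monoid_scheme \<Rightarrow> bool" where
  "finitely_generated G \<longleftrightarrow> (\<exists>S. finite_generating_set G S)"

definition word_value :: "('a, 'b) monoid_scheme \<Rightarrow> 'a list \<Rightarrow> 'a" where
  "word_value G ws = foldr (\<otimes>\<^bsub>G\<^esub>) ws \<one>\<^bsub>G\<^esub>"

definition growth_ball :: "('a, 'b) monoid_scheme \<Rightarrow> 'a set \<Rightarrow> nat \<Rightarrow> 'a set" where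
  "growth_ball G S R =
     {word_value G ws | ws. set ws \<subseteq> S \<union> m_inv G ` S \<and> length ws \<le> R}"

definition growth_function :: "('a, 'b) monoid_scheme \<Rightarrow> 'a set \<Rightarrow> nat \<Rightarrow> nat" where
  "growth_function G S R = card (growth_ball G S R)"

definition growth_rate :: "('a, 'b) monoid_scheme \<Rightarrow> 'a set \<Rightarrow> real" where
  "growth_rate G S = lim (\<lambda>R. root R (real (growth_function G S R)))"

definition exponential_growth :: "('a, 'b) monoid_scheme \<Rightarrow> bool" where
  "exponential_growth G \<longleftrightarrow> (\<exists>S. finite_generating_set G S \<and> growth_rate G S > 1)"

text \<open>The notion is only meant for finitely generated groups; finite generation is
  demanded explicitly because the infimum of the empty set of reals is unspecified.\<close>

definition uniform_exponential_growth :: "('a, 'b) monoid_scheme \<Rightarrow> bool" where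
  "uniform_exponential_growth G \<longleftrightarrow>
     finitely_generated G \<and> (INF S\<in>{S. finite_generating_set G S}. growth_rate G S) > 1"

definition nonuniform_exponential_growth :: "('a, 'b) monoid_scheme \<Rightarrow> bool" where
  "nonuniform_exponential_growth G \<longleftrightarrow>
     exponential_growth G \<and> \<not> uniform_exponential_growth G"

definition alpha :: real where
  "alpha = (THE a. a > 0 \<and>
     2 powr (3 - 3 / a) + 2 powr (2 - 2 / a) + 2 powr (1 - 1 / a) = 2)"

lemma alpha_ex1:
  "\<exists>!a::real. a > 0 \<and> 2 powr (3 - 3 / a) + 2 powr (2 - 2 / a) + 2 powr (1 - 1 / a) = 2"
proof -
  define f :: "real \<Rightarrow> real"
    where "f = (\<lambda>a. 2 powr (3 - 3 / a) + 2 powr (2 - 2 / a) + 2 powr (1 - 1 / a))"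
  have mono: "f a < f b" if "0 < a" "a < b" for a b
  proof -
    have "c / b < c / a" if "c > 0" for c :: real
      using \<open>0 < a\<close> \<open>a < b\<close> that by (simp add: divide_strict_left_mono)
    from this[of 1] this[of 2] this[of 3] show ?thesis
      unfolding f_def by (intro add_strict_mono) simp_all
  qed
  have "\<exists>x\<ge>1/2. x \<le> 1 \<and> f x = 2"
  proof (rule IVT')
    show "continuous_on {1/2..1} f"
      unfolding f_def by (intro continuous_intros) auto
    show "f (1/2) \<le> 2"
      by (simp add: f_def powr_minus)
  qed (simp_all add: f_def)
  then obtain x where x: "x > 0" "f x = 2" by force
  have "y = x" if "y > 0" "f y = 2" for y
    using mono[of x y] mono[of y x] x that by (cases x y rule: linorder_cases) auto
  with x show ?thesis unfolding f_def by blast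
qed

end

theory Submission
  imports Defs "HOL-Analysis.Convex"
begin

text \<open>Let the Grigorchuk group \<open>\<langle>a, b, c, d\<rangle>\<close> act on an orbit \<open>X\<close> of rays of the binary tree, and let \<open>B\<close> be
  a group generated by finitely many involutions \<open>\<beta>\<^sub>0, \<dots>, \<beta>\<^sub>k\<close>.  For every \<open>n\<close> the permutational wreath
  product of \<open>B\<close> over \<open>X\<close> is generated by \<open>a, b, c, d\<close> and the elements that place \<open>\<beta>\<^sub>i\<close> at the ray
  \<open>1\<^sup>n 1\<^sup>i 0 1\<^sup>\<infinity>\<close>, because the action is transitive.  On the first \<open>n\<close> levels of the tree these generators
  decompose like those of the Grigorchuk group, up to a finite group of decorations whose order does
  not depend on \<open>n\<close>; hence the weighted contraction argument that bounds the growth of the Grigorchuk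
  group by \<open>exp (K r\<^sup>\<alpha>)\<close> applies to all balls of radius at most \<open>n\<close>, with a constant independent of \<open>n\<close>.

  It remains to embed a countable group into such a \<open>B\<close> that moreover contains a lamplighter group,
  which makes the wreath product grow exponentially.\<close>

section \<open>Solving the growth recursion\<close>

text \<open>The derivative \<open>(K * a * x powr a - 2) / x\<close> is nonnegative from 1 on as
  soon as \<open>K * a\<close> is at least 2. The comparison function \<open>\<psi>\<close> of the
  growth recursion has this shape.\<close>

lemma powr_minus_ln_mono:
  fixes K a s t :: real
  assumes a: "0 < a" "a < 1" and K: "K \<ge> 2 / (a * (1 - a))" and "1 \<le> s" "s \<le> t"
  shows "K * s powr a - 2 * ln s \<le> K * t powr a - 2 * ln t"
proof -
  have Ka: "K * a \<ge> 2"
  proof -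
    have "2 / a \<le> 2 / (a * (1 - a))"
      using a by (intro divide_left_mono) auto
    then have "2 / a \<le> K" using K by (rule order_trans)
    then show ?thesis using a by (simp add: pos_divide_le_eq)
  qed
  have "\<exists>y. ((\<lambda>x. K * x powr a - 2 * ln x) has_real_derivative y) (at x) \<and> 0 \<le> y"
    if "s \<le> x" "x \<le> t" for x
  proof -
    have x: "1 \<le> x" using that assms by simp
    have "((\<lambda>x. K * x powr a - 2 * ln x) has_real_derivative (K * a * x powr a - 2) / x) (at x)"
      using x by (auto intro!: derivative_eq_intros simp: field_simps powr_diff)
    moreover have "x powr a \<ge> 1" using x a by (simp add: ge_one_powr_ge_zero)
    then have "2 * 1 \<le> K * a * x powr a" using Ka by (intro mult_mono) auto
    then have "0 \<le> (K * a * x powr a - 2) / x" using x by (intro divide_nonneg_nonneg) linarith+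
    ultimately show ?thesis by blast
  qed
  with \<open>s \<le> t\<close> show ?thesis
    by (rule DERIV_nonneg_imp_nondecreasing)
qed

text \<open>The negated function has second derivative
  \<open>(K * (a * (1 - a)) * x powr a - 2) / x\<^sup>2\<close>, which the lower bound on
  \<open>K\<close> makes nonnegative from 1 on.\<close>

lemma powr_minus_ln_midpoint_concave:
  fixes K a s t :: real
  assumes a: "0 < a" "a < 1" and K: "K \<ge> 2 / (a * (1 - a))" and s: "1 \<le> s" and t: "1 \<le> t"
  shows "(K * s powr a - 2 * ln s) + (K * t powr a - 2 * ln t)
    \<le> 2 * (K * ((s + t) / 2) powr a - 2 * ln ((s + t) / 2))"
proof -
  let ?f = "\<lambda>x::real. 2 * ln x - K * x powr a"
  have Ka: "K * (a * (1 - a)) \<ge> 2" using K a by (simp add: field_simps)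
  have "convex_on {1..} ?f"
  proof (rule f''_ge0_imp_convex)
    fix x :: real assume "x \<in> {1..}"
    then have x: "1 \<le> x" by simp
    show "DERIV ?f x :> 2 / x - K * a * x powr (a - 1)"
      using x by (auto intro!: derivative_eq_intros)
    show "DERIV (\<lambda>x. 2 / x - K * a * x powr (a - 1)) x :> - 2 / x\<^sup>2 - K * a * (a - 1) * x powr (a - 2)"
      using x by (auto intro!: derivative_eq_intros simp: power2_eq_square)
    have "x powr a \<ge> 1" using x a by (simp add: ge_one_powr_ge_zero)
    then have "K * (a * (1 - a)) * x powr a \<ge> 2 * 1" using Ka by (intro mult_mono) auto
    then have "(K * (a * (1 - a)) * x powr a - 2) / x\<^sup>2 \<ge> 0" by simp
    moreover have e: "x powr (a - 2) = x powr a / x\<^sup>2"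
      using x by (simp add: powr_diff)
    have "- 2 / Y - K * a * (a - 1) * (P / Y) = (K * (a * (1 - a)) * P - 2) / Y" for P Y :: real
      unfolding divide_inverse by (simp only: algebra_simps)
    ultimately show "- 2 / x\<^sup>2 - K * a * (a - 1) * x powr (a - 2) \<ge> 0" by (simp only: e)
  qed simp
  then have "?f ((1 - 1/2) *\<^sub>R s + (1/2) *\<^sub>R t) \<le> (1 - 1/2) * ?f s + (1/2) * ?f t"
    using s t by (intro convex_onD) auto
  moreover have "(1 - 1/2) *\<^sub>R s + (1/2) *\<^sub>R t = (s + t) / 2" by simp
  ultimately have "?f ((s + t) / 2) \<le> (1 - 1/2) * ?f s + (1/2) * ?f t" by (simp only:)
  moreover have "- v + - w \<le> 2 * - u" if "u \<le> (1 - 1/2) * v + (1/2) * w" for u v w :: real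
    using that by simp
  ultimately have "- ?f s + - ?f t \<le> 2 * - ?f ((s + t) / 2)" by blast
  then show ?thesis by (simp only: minus_diff_eq)
qed

text \<open>All four conditions hold for large \<open>r\<close>, since \<open>\<eta>\<close> is
  below 1 and a square outgrows a linear term. In the recursion they leave room for two truncated
  arguments, lower both arguments by at least 1, absorb the number of summands, and make the
  truncation in \<open>z\<close> inactive.\<close>

lemma recursion_threshold:
  fixes \<eta> A c :: real
  assumes "0 < \<eta>" "\<eta> < 1"
  shows "\<exists>\<rho>\<ge>0. \<forall>r\<ge>\<rho>. 2 \<le> \<eta> * (r - c) \<and> \<eta> * (r + A) \<le> r - 2 \<and>
    2 * (\<eta> * (r + A) + 1) * (2 / \<eta>) ^ 4 \<le> (r - c)\<^sup>2 \<and> c + 1 \<le> r"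
proof -
  define P where "P = (2 / \<eta>) ^ 4"
  define B where "B = \<bar>A\<bar> + \<bar>c\<bar> + 1"
  have P: "P > 0" unfolding P_def using assms by simp
  define \<rho> where "\<rho> = Max {c + 1 + 2 / \<eta>, (2 + \<eta> * A) / (1 - \<eta>), c + 4 * P + 4 * P * B, c + 1, 0}"
  have ge: "\<rho> \<ge> c + 1 + 2 / \<eta>" "\<rho> \<ge> (2 + \<eta> * A) / (1 - \<eta>)" "\<rho> \<ge> c + 4 * P + 4 * P * B" "\<rho> \<ge> c + 1" "\<rho> \<ge> 0"
    unfolding \<rho>_def by (rule Max_ge; simp)+
  have "2 \<le> \<eta> * (r - c)" if "r \<ge> \<rho>" for r
  proof -
    have "r - c \<ge> 2 / \<eta>" using that ge by linarith
    then show ?thesis using assms by (simp add: field_simps)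
  qed
  moreover have "\<eta> * (r + A) \<le> r - 2" if "r \<ge> \<rho>" for r
  proof -
    have "r \<ge> (2 + \<eta> * A) / (1 - \<eta>)" using that ge by linarith
    then show ?thesis using assms by (simp add: field_simps)
  qed
  moreover have "2 * (\<eta> * (r + A) + 1) * P \<le> (r - c)\<^sup>2" if "r \<ge> \<rho>" for r
  proof -
    define z where "z = r - c"
    have z: "z \<ge> 4 * P + 4 * P * B" "z \<ge> 1" using that ge unfolding z_def by linarith+
    have B: "B \<ge> 1" by (simp add: B_def)
    have "\<eta> * (r + A) \<le> \<eta> * (z + B)"
      using assms by (intro mult_left_mono) (auto simp: z_def B_def)
    also have "\<dots> \<le> 1 * (z + B)" using assms z B by (intro mult_right_mono) auto
    finally have "\<eta> * (r + A) + 1 \<le> z + 2 * B" using B by simp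
    then have "2 * (\<eta> * (r + A) + 1) * P \<le> 2 * (z + 2 * B) * P" using P by simp
    also have "\<dots> \<le> 2 * (z + 2 * B * z) * P" using P z B by simp
    also have "\<dots> = z * (2 * P + 4 * P * B)" by (simp add: algebra_simps)
    also have "\<dots> \<le> z * z" using z P by (intro mult_left_mono) auto
    finally show ?thesis by (simp add: z_def power2_eq_square)
  qed
  moreover have "c + 1 \<le> r" if "r \<ge> \<rho>" for r using that ge by linarith
  ultimately show ?thesis using ge unfolding P_def by blast
qed

text \<open>By concavity the bound for a product of two values is worst when both arguments are
  equal, and then \<open>(\<eta> / 2) powr a = 1 / 2\<close> makes the two main exponents add up to
  the original one. Each application of the recursion uses up one level, hence the range
  \<open>r \<le> real n\<close>.\<close>

lemma recursive_growth_bound: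
  fixes N :: "nat \<Rightarrow> real \<Rightarrow> real" and \<eta> A a :: real
  assumes a: "0 < a" "a < 1" and \<eta>: "0 < \<eta>" "\<eta> < 1" "(\<eta> / 2) powr a = 1 / 2" and A: "A \<ge> 0"
    and nonneg: "\<And>n r. 0 \<le> N n r"
    and small: "\<And>\<rho>. \<exists>C. \<forall>n. \<forall>r\<le>\<rho>. N n r \<le> C"
    and step: "\<And>n r. 0 \<le> r \<Longrightarrow> N (Suc n) r \<le>
      2 * (\<Sum>k\<le>nat \<lfloor>\<eta> * (r + A)\<rfloor>. N n (real k + 1) * N n (\<eta> * (r + A) - real k))"
  shows "\<exists>K>0. \<forall>n r. r \<le> real n \<longrightarrow> N n r \<le> exp (K * (max r 1) powr a)"
proof -
  text \<open>The shift \<^term>\<open>c\<close> absorbs the additive constants: the two shifted arguments of the recursion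
    add up to at most \<^term>\<open>\<eta>\<close> times the shifted original one.  The logarithmic term
    counters the number of summands, because it occurs twice on the right.\<close>
  define c where "c = (\<eta> * A + 3) / (1 - \<eta>)"
  have c: "(1 - \<eta>) * c = \<eta> * A + 3" "c > 0"
    using \<eta> A by (auto simp: c_def field_simps add_nonneg_pos intro!: divide_pos_pos)
  obtain \<rho> where \<rho>: "\<rho> \<ge> 0" and thr: "\<And>r. r \<ge> \<rho> \<Longrightarrow> 2 \<le> \<eta> * (r - c)"
      "\<And>r. r \<ge> \<rho> \<Longrightarrow> \<eta> * (r + A) \<le> r - 2"
      "\<And>r. r \<ge> \<rho> \<Longrightarrow> 2 * (\<eta> * (r + A) + 1) * (2 / \<eta>) ^ 4 \<le> (r - c)\<^sup>2"
      "\<And>r. r \<ge> \<rho> \<Longrightarrow> c + 1 \<le> r"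
    using recursion_threshold[OF \<eta>(1,2), of c A] by blast
  obtain C where C: "\<And>n r. r \<le> \<rho> \<Longrightarrow> N n r \<le> C" using small[of \<rho>] by blast
  \<comment> \<open>The first entry makes \<open>\<psi>\<close> monotone and concave; the second
    settles all \<open>r \<le> \<rho>\<close>, because \<open>\<psi> 1 = K\<close>.\<close>
  define K where "K = max (2 / (a * (1 - a))) (ln (max C 1))"
  have K: "K \<ge> 2 / (a * (1 - a))" "K \<ge> ln (max C 1)" by (auto simp: K_def)
  have Kpos: "K > 0" using K(1) a by (smt (verit) divide_pos_pos mult_pos_pos)
  define z where "z r = max (r - c) 1" for r
  define \<psi> where "\<psi> t = K * t powr a - 2 * ln t" for t
  have \<psi>1: "\<psi> 1 = K" by (simp add: \<psi>_def)
  have mono: "\<psi> s \<le> \<psi> t" if "1 \<le> s" "s \<le> t" for s t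
    unfolding \<psi>_def using powr_minus_ln_mono[OF a K(1)] that by simp
  have main: "N n r \<le> exp (\<psi> (z r))" if "r \<le> \<rho> + real n" for n r
    using that
  proof (induction n arbitrary: r)
    case (Suc n)
    show ?case
    proof (cases "r \<le> \<rho>")
      case False
      define s where "s = \<eta> * (r + A)"
      have r: "r \<ge> \<rho>" "r \<ge> 0" using False \<rho> by auto
      have s0: "s \<ge> 0" using r \<eta> A by (simp add: s_def)
      have zr: "z r = r - c" using thr(4)[OF r(1)] by (simp add: z_def)
      have zr1: "\<eta> * z r \<ge> 2" using thr(1)[OF r(1)] by (simp add: zr)
      have zpos: "z r > 0" by (simp add: z_def)
      have sr: "s \<le> r - 2" using thr(2)[OF r(1)] by (simp add: s_def)
      have zz: "s + 3 \<le> \<eta> * z r + c"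
        using c by (simp add: s_def zr algebra_simps)
      have term_le: "N n (real k + 1) * N n (s - real k) \<le> exp (2 * \<psi> (\<eta> * z r / 2))"
        if "k \<le> nat \<lfloor>s\<rfloor>" for k
      proof -
        have k: "real k \<le> s" using that s0 by (simp add: le_nat_iff le_floor_iff)
        let ?x = "real k + 1" and ?y = "s - real k"
        \<comment> \<open>If at most one argument is truncated to 1, \<open>zz\<close> suffices; if
          both are, the sum is 2 and \<open>zr1\<close> applies.\<close>
        have sum: "z ?x + z ?y \<le> \<eta> * z r"
          using zz zr1 k c(2) unfolding z_def by (auto simp: max_def)
        have "N n ?x \<le> exp (\<psi> (z ?x))" "N n ?y \<le> exp (\<psi> (z ?y))"
          using Suc.prems sr k by (auto intro!: Suc.IH)
        then have "N n ?x * N n ?y \<le> exp (\<psi> (z ?x) + \<psi> (z ?y))"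
          unfolding exp_add using nonneg by (intro mult_mono) auto
        moreover have "\<psi> (z ?x) + \<psi> (z ?y) \<le> 2 * \<psi> ((z ?x + z ?y) / 2)"
          unfolding \<psi>_def by (rule powr_minus_ln_midpoint_concave[OF a K(1)]) (auto simp: z_def)
        moreover have "\<psi> ((z ?x + z ?y) / 2) \<le> \<psi> (\<eta> * z r / 2)"
          using sum by (intro mono) (auto simp: z_def)
        ultimately show ?thesis by (smt (verit) exp_le_cancel_iff)
      qed
      have "N (Suc n) r \<le> 2 * (\<Sum>k\<le>nat \<lfloor>s\<rfloor>. N n (real k + 1) * N n (s - real k))"
        using step[OF r(2)] by (simp add: s_def)
      also have "\<dots> \<le> 2 * (\<Sum>k\<le>nat \<lfloor>s\<rfloor>. exp (2 * \<psi> (\<eta> * z r / 2)))"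
        using term_le by (intro mult_left_mono sum_mono) auto
      also have "\<dots> = 2 * (real (nat \<lfloor>s\<rfloor>) + 1) * exp (2 * \<psi> (\<eta> * z r / 2))" by simp
      also have "\<dots> \<le> 2 * (s + 1) * exp (2 * \<psi> (\<eta> * z r / 2))"
        using s0 by (intro mult_right_mono mult_left_mono) auto
      \<comment> \<open>Two copies of the logarithmic term give a fourth power in the denominator
        where the target needs only a square; the spare \<open>(z r)\<^sup>2\<close> pays for the
        number of summands.\<close>
      also have "exp (2 * \<psi> (\<eta> * z r / 2)) = (2 / \<eta>) ^ 4 * (exp (K * z r powr a) / z r ^ 4)"
      proof -
        have "(\<eta> * z r / 2) powr a = (\<eta> / 2) powr a * z r powr a"
          using \<eta>(1) zpos by (simp add: powr_mult flip: times_divide_eq_left)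
        also have "\<dots> = z r powr a / 2" by (simp add: \<eta>(3))
        finally have 1: "(\<eta> * z r / 2) powr a = z r powr a / 2" .
        have "2 * \<psi> (\<eta> * z r / 2) = K * z r powr a - real 4 * ln (\<eta> * z r / 2)"
          by (simp add: \<psi>_def 1)
        also have "exp \<dots> = exp (K * z r powr a) / (\<eta> * z r / 2) ^ 4"
          unfolding exp_diff exp_of_nat_mult using \<eta>(1) zpos by simp
        finally show ?thesis by (simp add: power_mult_distrib power_divide field_simps)
      qed
      also have "2 * (s + 1) * ((2 / \<eta>) ^ 4 * (exp (K * z r powr a) / z r ^ 4))
          = (2 * (s + 1) * (2 / \<eta>) ^ 4) * (exp (K * z r powr a) / z r ^ 4)" by simp
      also have "\<dots> \<le> (z r)\<^sup>2 * (exp (K * z r powr a) / z r ^ 4)"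
        using thr(3)[OF r(1)] by (intro mult_right_mono) (auto simp: s_def zr)
      also have "\<dots> = exp (\<psi> (z r))"
      proof -
        have "exp (\<psi> (z r)) = exp (K * z r powr a) / exp (real 2 * ln (z r))"
          by (simp add: \<psi>_def exp_diff)
        also have "\<dots> = exp (K * z r powr a) / (z r)\<^sup>2"
          unfolding exp_of_nat_mult using zpos by simp
        finally show ?thesis using zpos by (simp add: power_numeral_reduce field_simps)
      qed
      finally show ?thesis .
    next
      case True
      have "N (Suc n) r \<le> max C 1" using C[OF True, of "Suc n"] by simp
      also have "\<dots> = exp (ln (max C 1))" by simp
      also have "\<dots> \<le> exp (\<psi> 1)" using K(2) \<psi>1 by (simp only: exp_le_cancel_iff)
      also have "\<dots> \<le> exp (\<psi> (z r))" using mono[of 1 "z r"] by (simp add: z_def)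
      finally show ?thesis .
    qed
  next
    case 0
    then have "r \<le> \<rho>" by simp
    have "N 0 r \<le> max C 1" using C[OF \<open>r \<le> \<rho>\<close>, of 0] by simp
    also have "\<dots> = exp (ln (max C 1))" by simp
    also have "\<dots> \<le> exp (\<psi> 1)" using K(2) \<psi>1 by (simp only: exp_le_cancel_iff)
    also have "\<dots> \<le> exp (\<psi> (z r))" using mono[of 1 "z r"] by (simp add: z_def)
    finally show ?case .
  qed
  have "N n r \<le> exp (K * (max r 1) powr a)" if "r \<le> real n" for n r
  proof -
    have "N n r \<le> exp (\<psi> (z r))" using main that \<rho> by simp
    also have "\<psi> (z r) \<le> K * z r powr a" by (simp add: \<psi>_def z_def)
    also have "\<dots> \<le> K * (max r 1) powr a"
      using Kpos a c by (intro mult_left_mono powr_mono2) (auto simp: z_def)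
    finally show ?thesis by simp
  qed
  then show ?thesis using Kpos by blast
qed

section \<open>The exponent \<alpha> and the contraction ratio\<close>

lemma alpha_props:
  shows "0 < alpha"
    and "2 powr (3 - 3 / alpha) + 2 powr (2 - 2 / alpha) + 2 powr (1 - 1 / alpha) = 2"
  using theI'[OF alpha_ex1] unfolding alpha_def[symmetric] by auto

lemma alpha_less_1: "alpha < 1"
proof (rule ccontr)
  assume "\<not> alpha < 1"
  then have "1 / alpha \<le> 1" "2 / alpha \<le> 2" "3 / alpha \<le> 3" using alpha_props(1) by (simp_all add: field_simps)
  then have "2 powr (3 - 3 / alpha) \<ge> 1" "2 powr (2 - 2 / alpha) \<ge> 1" "2 powr (1 - 1 / alpha) \<ge> 1"
    by (simp_all add: ge_one_powr_ge_zero)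
  then show False using alpha_props(2) by linarith
qed

text \<open>The factor by which passing to sections shrinks the weighted length. In terms of it the
  equation for \<alpha> is a cubic, and \<open>(eta / 2) powr alpha = 1 / 2\<close> is the relation
  that the recursion asks for.\<close>

definition eta :: real where "eta = 2 powr (1 - 1 / alpha)"

lemma eta_bounds: "0 < eta" "eta < 1"
proof -
  show "0 < eta" by (simp add: eta_def)
  have "1 / alpha > 1" using alpha_props(1) alpha_less_1 by simp
  then show "eta < 1" unfolding eta_def by (intro powr_less_one) auto
qed

lemma eta_eq: "eta ^ 3 + eta\<^sup>2 + eta = 2"
proof -
  have "eta ^ n = 2 powr (real n - real n / alpha)" for n
    by (simp add: eta_def powr_power right_diff_distrib mult.commute)
  from this[of 3] this[of 2] this[of 1] show ?thesis using alpha_props(2) by simp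
qed

lemma eta_alpha: "(eta / 2) powr alpha = 1 / 2"
proof -
  have "eta / 2 = 2 powr (- (1 / alpha))" by (simp add: eta_def powr_diff powr_minus field_simps)
  then have "(eta / 2) powr alpha = 2 powr (- (1 / alpha) * alpha)" by (simp only: powr_powr)
  then show ?thesis using alpha_props(1) by (simp add: powr_minus)
qed

section \<open>Decorated Grigorchuk words\<close>

text \<open>An eventually constant ray \<open>x\<^sub>0 x\<^sub>1 \<dots> 1\<^sup>\<infinity>\<close> is encoded by the natural number whose binary digits,
  least significant first, are \<open>1 - x\<^sub>i\<close>; so \<open>1\<^sup>\<infinity>\<close> is 0, and the subtree below the digit 1 consists of
  the even numbers.  The recursion is \<open>b = (a, c)\<close>, \<open>c = (a, d)\<close>, \<open>d = (1, b)\<close>, where the first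
  component acts below the digit 0.\<close>

datatype kind = KI | KB | KC | KD

fun nxt :: "kind \<Rightarrow> kind" where
  "nxt KI = KI" | "nxt KB = KC" | "nxt KC = KD" | "nxt KD = KB"

fun flips :: "kind \<Rightarrow> bool" where
  "flips KI = False" | "flips KB = True" | "flips KC = True" | "flips KD = False"

fun kmult :: "kind \<Rightarrow> kind \<Rightarrow> kind" where
  "kmult KI l = l"
| "kmult k KI = k"
| "kmult KB KB = KI" | "kmult KB KC = KD" | "kmult KB KD = KC"
| "kmult KC KB = KD" | "kmult KC KC = KI" | "kmult KC KD = KB"
| "kmult KD KB = KC" | "kmult KD KC = KB" | "kmult KD KD = KI"

lemma UNIV_kind: "UNIV = {KI, KB, KC, KD}"
  using kind.exhaust by auto

lemma nxt_kmult: "nxt (kmult k l) = kmult (nxt k) (nxt l)"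
  by (cases k; cases l) auto

lemma flips_kmult: "flips (kmult k l) \<longleftrightarrow> flips k \<noteq> flips l"
  by (cases k; cases l) auto

lemma kmult_self [simp]: "kmult k k = KI"
  by (cases k) auto

definition aact :: "nat \<Rightarrow> nat" where
  "aact x = (if even x then x + 1 else x - 1)"

text \<open>The clause for 0 ensures termination: the ray of all ones has no digit 0 at which the
  recursion could stop, and b, c, d fix it.\<close>

fun vact :: "kind \<Rightarrow> nat \<Rightarrow> nat" where
  "vact k x = (if x = 0 then 0 else if even x then 2 * vact (nxt k) (x div 2)
     else if flips k then 2 * aact (x div 2) + 1 else x)"

declare vact.simps [simp del]

lemma aact_aact [simp]: "aact (aact x) = x"
  by (auto simp: aact_def)

lemma aact_even [simp]: "aact (2 * x) = Suc (2 * x)" and aact_odd [simp]: "aact (Suc (2 * x)) = 2 * x"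
  by (auto simp: aact_def)

lemma vact_0 [simp]: "vact k 0 = 0"
  by (simp add: vact.simps)

lemma vact_even [simp]: "vact k (2 * x) = 2 * vact (nxt k) x"
  by (cases "x = 0") (auto simp: vact.simps[of k "2 * x"])

lemma vact_odd [simp]: "vact k (Suc (2 * x)) = Suc (2 * (if flips k then aact x else x))"
  by (simp add: vact.simps[of k "Suc (2 * x)"])

lemma nat_binary_induct [case_names zero even odd]:
  assumes "P 0" "\<And>x. P x \<Longrightarrow> P (2 * x)" "\<And>x. P x \<Longrightarrow> P (Suc (2 * x))"
  shows "P (x :: nat)"
proof (induction x rule: less_induct)
  case (less x)
  show ?case
  proof (cases "x = 0")
    case False
    then have P: "P (x div 2)" by (intro less.IH) auto
    have "x = 2 * (x div 2) \<or> x = Suc (2 * (x div 2))" by presburger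
    with assms(2)[OF P] assms(3)[OF P] show ?thesis by metis
  qed (simp add: assms(1))
qed

text \<open>\<open>nxt\<close> is an endomorphism of the Klein four-group \<open>kmult\<close> and
  \<open>flips\<close> a homomorphism to the group of order 2, so the product rule passes down the
  digits.\<close>

lemma vact_vact: "vact k (vact l x) = vact (kmult k l) x"
  by (induction x arbitrary: k l rule: nat_binary_induct) (auto simp: nxt_kmult flips_kmult)

lemma vact_KI [simp]: "vact KI x = x"
  by (induction x rule: nat_binary_induct) auto

lemma vact_invol [simp]: "vact k (vact k x) = x"
  by (simp add: vact_vact)

section \<open>Weights of the Grigorchuk generators\<close>

definition wA :: real where "wA = 1 - eta ^ 3"

fun kwt :: "kind \<Rightarrow> real" where
  "kwt KI = 0" | "kwt KB = eta ^ 3" | "kwt KC = 1 - eta\<^sup>2" | "kwt KD = 1 - eta"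

text \<open>The weights are the solution, unique up to scaling, of the eigenvector equations
  \<^term>\<open>kwt (nxt k) + (if flips k then wA else 0) = eta * (kwt k + wA)\<close> with \<^term>\<open>k \<noteq> KI\<close>.\<close>

lemma eta_powers: "eta ^ 3 < eta\<^sup>2" "eta\<^sup>2 < eta" "0 < eta ^ 3" "0 < eta\<^sup>2" "1 < eta + eta\<^sup>2"
    "eta ^ 4 = 2 * eta - eta\<^sup>2 - eta ^ 3"
proof -
  note b = eta_bounds
  show 1: "eta\<^sup>2 < eta" "eta ^ 3 < eta\<^sup>2" "0 < eta ^ 3" "0 < eta\<^sup>2"
    using b by (simp_all add: power2_eq_square power3_eq_cube)
  have "eta * (eta\<^sup>2 + eta + 1) = 2"
    using eta_eq by (simp add: power2_eq_square power3_eq_cube algebra_simps)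
  moreover have "eta * (eta\<^sup>2 + eta + 1) < 1 * (eta\<^sup>2 + eta + 1)"
    by (intro mult_strict_right_mono) (use b 1 in linarith)+
  ultimately show "1 < eta + eta\<^sup>2" by simp
  have "eta * (eta ^ 3 + eta\<^sup>2 + eta) = eta * 2" by (simp add: eta_eq)
  then show "eta ^ 4 = 2 * eta - eta\<^sup>2 - eta ^ 3"
    by (simp add: power2_eq_square power3_eq_cube power4_eq_xxxx algebra_simps)
qed

lemma wA_pos: "wA > 0" and wA_le_1: "wA \<le> 1"
  unfolding wA_def using eta_powers eta_bounds by linarith+

lemma kwt_nonneg: "0 \<le> kwt k" and kwt_le_1: "kwt k \<le> 1"
  by (cases k; simp only: kwt.simps; use eta_powers eta_bounds in linarith)+

text \<open>For b = cd this is an equality, by \<open>eta_eq\<close>.\<close>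

lemma kwt_kmult: "kwt (kmult k l) \<le> kwt k + kwt l"
  by (cases k; cases l; simp only: kmult.simps kwt.simps; use eta_powers eta_bounds eta_eq in linarith)

lemma kwt_KD_le: "k \<noteq> KI \<Longrightarrow> kwt KD \<le> kwt k"
  by (cases k; simp only: kwt.simps simp_thms; use eta_powers eta_bounds eta_eq in linarith)

lemma kwt_nxt:
  assumes "k \<noteq> KI"
  shows "kwt (nxt k) + (if flips k then wA else 0) \<le> eta * (kwt k + wA)"
proof -
  have *: "eta * eta = eta\<^sup>2" "eta * eta\<^sup>2 = eta ^ 3" "eta * eta ^ 3 = eta ^ 4"
    by (simp_all add: power_numeral_reduce)
  show ?thesis
    using assms
    by (cases k; simp only: kwt.simps nxt.simps flips.simps wA_def if_True if_False simp_thms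
      ring_distribs * mult_1_right; use eta_eq eta_powers in linarith)
qed

text \<open>A decorated letter of kind \<open>KI\<close> has a section of kind \<open>KI\<close>
  again and is charged the weight of d at both levels, so this weight has to contract against
  itself.\<close>

lemma kwt_KD_contract: "kwt KD \<le> eta * (kwt KD + wA)"
proof -
  have "kwt KB \<le> eta * (kwt KD + wA)" using kwt_nxt[of KD] by simp
  then show ?thesis using kwt_KD_le[of KB] by simp
qed

text \<open>\<open>emb True\<close> and \<open>emb False\<close> identify the whole space with its
  parts below the digits 1 and 0.\<close>

definition emb :: "bool \<Rightarrow> nat \<times> 'w \<Rightarrow> nat \<times> 'w" where
  "emb p z = (2 * fst z + of_bool (\<not> p), snd z)"

lemma emb_eq_iff: "emb p z = emb q z' \<longleftrightarrow> p = q \<and> z = z'"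
proof -
  have "2 * a + of_bool (\<not> p) = 2 * b + of_bool (\<not> q) \<longleftrightarrow> p = q \<and> a = b" for a b :: nat
    by (cases p; cases q; simp; presburger)
  then show ?thesis by (auto simp: emb_def prod_eq_iff)
qed

lemma emb_cases: obtains p z' where "z = emb p z'"
proof -
  have "fst z = 2 * (fst z div 2) + of_bool (\<not> even (fst z))" by (cases "even (fst z)") auto
  then have "z = emb (even (fst z)) (fst z div 2, snd z)" by (simp add: emb_def prod_eq_iff)
  then show ?thesis using that by blast
qed

definition Aact :: "nat \<times> 'w \<Rightarrow> nat \<times> 'w" where
  "Aact z = (aact (fst z), snd z)"

lemma Aact_invol [simp]: "Aact (Aact z) = z"
  by (simp add: Aact_def)

lemma Aact_emb: "Aact (emb p z) = emb (\<not> p) z"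
  by (cases p) (auto simp: Aact_def emb_def)

text \<open>Level \<^term>\<open>n\<close> puts the base decoration on the subtree below the vertex \<open>1\<^sup>n\<close>
  (digit \<open>1\<close> of a ray being encoded by the bit 0).\<close>

locale decoration =
  fixes \<beta> :: "nat \<Rightarrow> 'w \<Rightarrow> 'w"
  assumes invol: "\<beta> x (\<beta> x w) = w"
    and vact_inv: "\<beta> (vact k x) = \<beta> x"
    and fin_supp: "finite {x. \<beta> x \<noteq> id}"
begin

fun decor :: "nat \<Rightarrow> nat \<Rightarrow> 'w \<Rightarrow> 'w" where
  "decor 0 x = \<beta> x"
| "decor (Suc n) x = (if even x then decor n (x div 2) else id)"

lemma decor_invol [simp]: "decor n x (decor n x w) = w"
  by (induction n arbitrary: x) (auto simp: invol)

lemma decor_vact [simp]: "decor n (vact k x) = decor n x"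
proof (induction n arbitrary: x k)
  case (Suc n)
  show ?case
  proof (cases "even x")
    case True
    then obtain y where "x = 2 * y" by auto
    then show ?thesis using Suc by simp
  next
    case False
    then obtain y where "x = Suc (2 * y)" by (auto elim: oddE)
    then show ?thesis by simp
  qed
qed (simp add: vact_inv)

text \<open>Going up one level only doubles the numbers of the decorated rays. This is what makes
  all later constants independent of \<open>n\<close>.\<close>

lemma decor_supp: "finite {x. decor n x \<noteq> id}" "card {x. decor n x \<noteq> id} \<le> card {x. \<beta> x \<noteq> id}"
proof -
  have "finite {x. decor n x \<noteq> id} \<and> card {x. decor n x \<noteq> id} \<le> card {x. \<beta> x \<noteq> id}"
  proof (induction n)
    case (Suc n)
    have "{x. decor (Suc n) x \<noteq> id} \<subseteq> (\<lambda>x. 2 * x) ` {x. decor n x \<noteq> id}"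
      by (auto split: if_splits elim!: evenE)
    then show ?case using Suc by (meson card_image_le card_mono finite_imageI finite_subset le_trans)
  next
    case 0
    show ?case unfolding decor.simps using fin_supp by blast
  qed
  then show "finite {x. decor n x \<noteq> id}" "card {x. decor n x \<noteq> id} \<le> card {x. \<beta> x \<noteq> id}" by auto
qed

section \<open>Decorated letters and their sections\<close>

definition letter :: "nat \<Rightarrow> kind \<Rightarrow> nat set \<Rightarrow> nat \<times> 'w \<Rightarrow> nat \<times> 'w" where
  "letter n k T z = (vact k (fst z), if fst z \<in> T then decor n (fst z) (snd z) else snd z)"

text \<open>A ray and its image under \<open>vact l\<close> carry the same involution, so two
  decorations met along the way cancel.\<close>

lemma letter_comp: "letter n k S \<circ> letter n l T = letter n (kmult k l) {x. (x \<in> T) \<noteq> (vact l x \<in> S)}"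
  by (auto simp: fun_eq_iff letter_def vact_vact)

lemma letter_empty [simp]: "letter n KI {} = id"
  by (auto simp: letter_def)

text \<open>All decorations sit below the digit 1, so the section there is a letter one level down,
  while the section below 0 is an undecorated a or trivial.\<close>

lemma letter_emb_True: "letter (Suc n) k T (emb True z) = emb True (letter n (nxt k) {y. 2 * y \<in> T} z)"
  by (simp add: letter_def emb_def)

lemma letter_emb_False: "letter (Suc n) k T (emb False z) = emb False ((if flips k then Aact else id) z)"
  by (simp add: letter_def emb_def Aact_def)

lemma letter_restrict: "letter n k T = letter n k (T \<inter> {x. decor n x \<noteq> id})"
  by (auto simp: fun_eq_iff letter_def)

definition letters :: "nat \<Rightarrow> (nat \<times> 'w \<Rightarrow> nat \<times> 'w) set" where
  "letters n = {letter n k T | k T. True}"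

lemma letters_finite: "finite (letters n)"
  and letters_card: "card (letters n) \<le> 4 * 2 ^ card {x. \<beta> x \<noteq> id}"
proof -
  let ?P = "(UNIV :: kind set) \<times> Pow {x. decor n x \<noteq> id}"
  have sub: "letters n \<subseteq> (\<lambda>(k, T). letter n k T) ` ?P"
  proof
    fix g assume "g \<in> letters n"
    then obtain k T where "g = letter n k (T \<inter> {x. decor n x \<noteq> id})"
      unfolding letters_def using letter_restrict by blast
    then show "g \<in> (\<lambda>(k, T). letter n k T) ` ?P" by (intro image_eqI[of _ _ "(k, _)"]) auto
  qed
  have fin: "finite ?P" by (simp add: UNIV_kind decor_supp)
  then show "finite (letters n)" using sub finite_surj by blast
  have "card (letters n) \<le> card ?P" using sub fin by (rule surj_card_le[rotated])
  also have "\<dots> = 4 * 2 ^ card {x. decor n x \<noteq> id}"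
    by (simp add: card_cartesian_product card_Pow decor_supp UNIV_kind)
  also have "\<dots> \<le> 4 * 2 ^ card {x. \<beta> x \<noteq> id}" using decor_supp by simp
  finally show "card (letters n) \<le> 4 * 2 ^ card {x. \<beta> x \<noteq> id}" .
qed

text \<open>A nontrivial pure decoration is charged the least weight of a nontrivial kind. Other
  kinds carry their decoration for free.\<close>

definition wt :: "kind \<Rightarrow> (nat \<times> 'w \<Rightarrow> nat \<times> 'w) \<Rightarrow> real" where
  "wt k g = (if k = KI \<and> g \<noteq> id then kwt KD else kwt k)"

lemma wt_nonneg: "0 \<le> wt k g"
  by (simp add: wt_def kwt_nonneg del: kwt.simps)

lemma wt_le_1: "wt k g \<le> 1"
  by (simp add: wt_def kwt_le_1 del: kwt.simps)

text \<open>Only a product of kind \<open>KI\<close> needs an argument beyond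
  \<open>kwt_kmult\<close>. If it is not the identity, it costs \<open>kwt KD\<close>, which one of
  the factors already pays.\<close>

lemma wt_comp: "wt (kmult k l) (g \<circ> h) \<le> wt k g + wt l h"
proof (cases "kmult k l = KI")
  case True
  then have "k = l" by (cases k; cases l) auto
  show ?thesis
  proof (cases "k = KI")
    case True
    then show ?thesis using \<open>k = l\<close> kwt_nonneg[of KD] by (auto simp: wt_def simp del: kwt.simps) auto
  next
    case False
    then show ?thesis using \<open>k = l\<close> kwt_KD_le[OF False] kwt_nonneg[of k]
      by (auto simp: wt_def simp del: kwt.simps) auto
  qed
next
  case False
  then have "wt (kmult k l) (g \<circ> h) \<le> kwt k + kwt l"
    using kwt_kmult by (simp add: wt_def)
  moreover have "kwt m \<le> wt m f" for m f using kwt_nonneg[of KD] by (auto simp: wt_def)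
  ultimately show ?thesis by (meson add_mono order_trans)
qed

text \<open>A letter and one a are charged together on the right, against both sections of the
  letter on the left. An identity letter has an identity section because \<open>emb True\<close> is
  injective.\<close>

lemma wt_contract:
  "wt (nxt k) (letter n (nxt k) {y. 2 * y \<in> T}) + (if flips k then wA else 0)
    \<le> eta * (wt k (letter (Suc n) k T) + wA)"
proof (cases "k = KI")
  case True
  show ?thesis
  proof (cases "letter (Suc n) k T = id")
    case True
    have "emb True (letter n (nxt k) {y. 2 * y \<in> T} z) = emb True z" for z
      by (simp add: True flip: letter_emb_True)
    then have "letter n (nxt k) {y. 2 * y \<in> T} = id" by (auto simp: fun_eq_iff emb_eq_iff)
    then show ?thesis using \<open>k = KI\<close> True eta_bounds wA_pos by (simp add: wt_def)
  next
    case False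
    then show ?thesis using \<open>k = KI\<close> kwt_KD_contract eta_bounds wA_pos kwt_nonneg[of KD]
      by (auto simp: wt_def simp del: kwt.simps) (simp add: kwt.simps)
  qed
next
  case False
  then have "nxt k \<noteq> KI" by (cases k) auto
  then show ?thesis using kwt_nxt[OF False] False by (simp add: wt_def del: kwt.simps)
qed

text \<open>The ball of weighted radius \<open>r\<close>, in terms of alternating words that begin
  and end with a letter, possibly the identity of weight 0. Thus every a is paired with the letter
  on its left.\<close>

inductive reach :: "nat \<Rightarrow> real \<Rightarrow> (nat \<times> 'w \<Rightarrow> nat \<times> 'w) \<Rightarrow> bool" for n where
  base: "wt k (letter n k T) \<le> r \<Longrightarrow> reach n r (letter n k T)"
| step: "reach n r h \<Longrightarrow> wt k (letter n k T) + wA + r \<le> r' \<Longrightarrow> reach n r' (letter n k T \<circ> Aact \<circ> h)"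

lemma reach_nonneg: "reach n r g \<Longrightarrow> 0 \<le> r"
  by (induction rule: reach.induct) (use wt_nonneg wA_pos in \<open>smt (verit)\<close>)+

lemma reach_mono: "reach n r g \<Longrightarrow> r \<le> r' \<Longrightarrow> reach n r' g"
proof (induction arbitrary: r' rule: reach.induct)
  case (base k T r)
  then show ?case by (intro reach.base) simp
next
  case (step r h k T s)
  show ?case by (rule reach.step[OF step.hyps(1)]) (use step in simp)
qed

lemma reach_id: "0 \<le> r \<Longrightarrow> reach n r id"
  using reach.base[of KI n "{}" r] by (simp add: wt_def)

lemma reach_A: "reach n r g \<Longrightarrow> reach n (r + wA) (Aact \<circ> g)"
  using reach.step[of n r g KI "{}" "r + wA"] by (simp add: wt_def)

text \<open>The new letter merges with the leading one, at no extra cost by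
  \<open>wt_comp\<close>.\<close>

lemma reach_letter: "reach n r g \<Longrightarrow> reach n (r + wt k (letter n k T)) (letter n k T \<circ> g)"
proof (induction rule: reach.induct)
  case (base l S r)
  have "wt (kmult k l) (letter n k T \<circ> letter n l S) \<le> r + wt k (letter n k T)"
    using wt_comp[of k l "letter n k T" "letter n l S"] base by simp
  then show ?case unfolding letter_comp by (rule reach.base)
next
  case (step r h l S r')
  have "wt (kmult k l) (letter n k T \<circ> letter n l S) + wA + r \<le> r' + wt k (letter n k T)"
    using wt_comp[of k l "letter n k T" "letter n l S"] step by simp
  then have "reach n (r' + wt k (letter n k T)) ((letter n k T \<circ> letter n l S) \<circ> Aact \<circ> h)"
    unfolding letter_comp using step by (intro reach.step)
  then show ?case unfolding comp_assoc .
qed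

text \<open>Each pair of a letter and an a contracts by \<open>eta\<close>; the last letter has no
  partner, whence the extra \<open>wA\<close>. The Boolean \<open>p\<close> is true if the two
  subtrees are kept and false if they are exchanged.\<close>

lemma reach_sections:
  assumes "reach (Suc n) r g"
  shows "\<exists>p gs rs. (\<forall>q. reach n (rs q) (gs q)) \<and> rs True + rs False \<le> eta * (r + wA) \<and>
    (\<forall>q z. g (emb q z) = emb (q = p) (gs q z))"
  using assms
proof (induction rule: reach.induct)
  case (base k T r)
  let ?l = "letter n (nxt k) {y. 2 * y \<in> T}" and ?a = "if flips k then Aact else id"
  let ?gs = "\<lambda>q. if q then ?l else ?a"
  let ?rs = "\<lambda>q. if q then wt (nxt k) ?l else (if flips k then wA else 0)"
  have "reach n (?rs q) (?gs q)" for q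
    using reach_id[of 0 n] reach_A[of n 0 id] by (auto intro: reach.base)
  moreover have "?rs True + ?rs False \<le> eta * (r + wA)"
  proof -
    have "?rs True + ?rs False \<le> eta * (wt k (letter (Suc n) k T) + wA)" using wt_contract by simp
    also have "\<dots> \<le> eta * (r + wA)" using base eta_bounds by simp
    finally show ?thesis .
  qed
  moreover have "letter (Suc n) k T (emb q z) = emb (q = True) (?gs q z)" for q z
    by (cases q) (auto simp: letter_emb_True letter_emb_False)
  ultimately show ?case by (intro exI[of _ True] exI[of _ ?gs] exI[of _ ?rs]) blast
next
  case (step r h k T r')
  then obtain p hs rs where hs: "\<And>q. reach n (rs q) (hs q)" "rs True + rs False \<le> eta * (r + wA)"
      "\<And>q z. h (emb q z) = emb (q = p) (hs q z)" by blast
  let ?l = "letter n (nxt k) {y. 2 * y \<in> T}" and ?a = "if flips k then Aact else id"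
  \<comment> \<open>After \<open>h\<close> and then a, the subtree \<open>q\<close> lies below the
    digit 1 iff \<open>q = (\<not> p)\<close>; that decides which section of the new letter it
    meets.\<close>
  let ?gs = "\<lambda>q. (if q = (\<not> p) then ?l else ?a) \<circ> hs q"
  let ?rs = "\<lambda>q. rs q + (if q = (\<not> p) then wt (nxt k) ?l else (if flips k then wA else 0))"
  have "reach n (?rs q) (?gs q)" for q
    using hs(1)[of q] by (auto intro: reach_letter reach_A)
  moreover have "?rs True + ?rs False \<le> eta * (r' + wA)"
  proof -
    have "?rs True + ?rs False \<le> eta * (r + wA) + eta * (wt k (letter (Suc n) k T) + wA)"
      using hs(2) wt_contract[of k n T] by (cases p) auto
    also have "\<dots> = eta * ((wt k (letter (Suc n) k T) + wA + r) + wA)" by (simp add: algebra_simps)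
    also have "\<dots> \<le> eta * (r' + wA)" using step eta_bounds by simp
    finally show ?thesis .
  qed
  moreover have "(letter (Suc n) k T \<circ> Aact \<circ> h) (emb q z) = emb (q = (\<not> p)) (?gs q z)" for q z
  proof -
    have "(letter (Suc n) k T \<circ> Aact \<circ> h) (emb q z) = letter (Suc n) k T (emb (q = (\<not> p)) (hs q z))"
      by (simp add: hs(3) Aact_emb)
    then show ?thesis by (cases "q = (\<not> p)") (simp_all add: letter_emb_True letter_emb_False)
  qed
  ultimately show ?case by (intro exI[of _ "\<not> p"] exI[of _ ?gs] exI[of _ ?rs]) blast
qed

section \<open>Counting elements of bounded weight\<close>

fun layer :: "nat \<Rightarrow> nat \<Rightarrow> (nat \<times> 'w \<Rightarrow> nat \<times> 'w) set" where
  "layer n 0 = letters n"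
| "layer n (Suc j) = letters n \<union> (\<lambda>(l, h). l \<circ> Aact \<circ> h) ` (letters n \<times> layer n j)"

lemma layer_mono: "i \<le> j \<Longrightarrow> layer n i \<subseteq> layer n j"
proof (induction j arbitrary: i)
  case (Suc j)
  show ?case
  proof (cases i)
    case (Suc i')
    then have "layer n i' \<subseteq> layer n j" using Suc.IH[of i'] Suc.prems by simp
    then show ?thesis using Suc by auto
  qed auto
qed simp

lemma layer_card:
  defines "M \<equiv> 4 * 2 ^ card {x. \<beta> x \<noteq> id}"
  shows "finite (layer n j)" "card (layer n j) \<le> (M + 1) ^ (j + 1)"
proof -
  have "finite (layer n j) \<and> card (layer n j) \<le> (M + 1) ^ (j + 1)"
  proof (induction j)
    case 0
    then show ?case using letters_finite letters_card[of n] by (simp add: M_def)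
  next
    case (Suc j)
    let ?I = "(\<lambda>(l, h). l \<circ> Aact \<circ> h) ` (letters n \<times> layer n j)"
    have "card (layer n (Suc j)) \<le> card (letters n) + card ?I" by (simp add: card_Un_le)
    also have "card ?I \<le> card (letters n \<times> layer n j)"
      using Suc letters_finite by (intro card_image_le) auto
    also have "\<dots> \<le> M * (M + 1) ^ (j + 1)"
      using Suc letters_card[of n] by (simp only: card_cartesian_product M_def mult_le_mono)
    also have "card (letters n) \<le> (M + 1) ^ (j + 1)"
      using letters_card[of n] self_le_power[of "M + 1" "j + 1"] by (simp add: M_def)
    finally show ?case using Suc letters_finite by simp
  qed
  then show "finite (layer n j)" "card (layer n j) \<le> (M + 1) ^ (j + 1)" by auto
qed

text \<open>Every a costs \<open>wA\<close>, so at most \<open>j\<close> of them occur. With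
  \<open>layer_card\<close> this gives a crude bound, uniform in \<open>n\<close>, for the start of
  the recursion.\<close>

lemma reach_layer: "reach n r g \<Longrightarrow> r < wA * (real j + 1) \<Longrightarrow> g \<in> layer n j"
proof (induction arbitrary: j rule: reach.induct)
  case (base k T r)
  have "letter n k T \<in> layer n 0" by (auto simp: letters_def)
  then show ?case using layer_mono[of 0 j] by blast
next
  case (step r h k T r')
  have "wA + r \<le> r'" using step wt_nonneg[of k "letter n k T"] by simp
  then have *: "r < wA * real j" using step.prems by (simp add: algebra_simps)
  then obtain i where i: "j = Suc i" using reach_nonneg[OF step.hyps(1)] by (cases j) auto
  with * have "h \<in> layer n i" by (intro step.IH) (simp add: algebra_simps)
  moreover have "letter n k T \<in> letters n" by (auto simp: letters_def)
  ultimately have "(\<lambda>(l, h). l \<circ> Aact \<circ> h) (letter n k T, h) \<in> layer n j"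
    unfolding i layer.simps by blast
  then show ?case by (simp only: prod.case)
qed

lemma reach_subset_layer: "\<exists>j. \<forall>n. \<forall>r\<le>\<rho>. {g. reach n r g} \<subseteq> layer n j"
proof -
  obtain j :: nat where "\<rho> / wA < real j" using reals_Archimedean2 by blast
  then have "\<rho> < wA * real j" using wA_pos by (simp add: field_simps)
  then have "\<rho> < wA * (real j + 1)" using wA_pos by (simp add: algebra_simps)
  then have "{g. reach n r g} \<subseteq> layer n j" if "r \<le> \<rho>" for n r using that reach_layer by auto
  then show ?thesis by blast
qed

lemma reach_finite: "finite {g. reach n r g}"
  using reach_subset_layer[of r] layer_card(1) finite_subset by blast

definition glue :: "bool \<Rightarrow> (nat \<times> 'w \<Rightarrow> nat \<times> 'w) \<Rightarrow> (nat \<times> 'w \<Rightarrow> nat \<times> 'w) \<Rightarrow> nat \<times> 'w \<Rightarrow> nat \<times> 'w" where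
  "glue p g h z = emb (even (fst z) = p) ((if even (fst z) then g else h) (fst z div 2, snd z))"

lemma glue_emb: "glue p g h (emb q z) = emb (q = p) ((if q then g else h) z)"
  by (auto simp: glue_def emb_def)

text \<open>An element is determined by its two sections and by whether it exchanges the subtrees,
  which accounts for the factor 2.\<close>

lemma reach_card_step:
  assumes "0 \<le> r"
  shows "real (card {g. reach (Suc n) r g}) \<le> 2 * (\<Sum>k\<le>nat \<lfloor>eta * (r + wA)\<rfloor>.
    real (card {g. reach n (real k + 1) g}) * real (card {g. reach n (eta * (r + wA) - real k) g}))"
proof -
  define s where "s = eta * (r + wA)"
  let ?B = "\<lambda>r. {g. reach n r g}"
  let ?P = "(\<Union>k\<in>{..nat \<lfloor>s\<rfloor>}. ?B (real k + 1) \<times> ?B (s - real k))"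
  have sub: "{g. reach (Suc n) r g} \<subseteq> (\<lambda>(p, g, h). glue p g h) ` (UNIV \<times> ?P)"
  proof
    fix g assume "g \<in> {g. reach (Suc n) r g}"
    then obtain p gs rs where gs: "\<And>q. reach n (rs q) (gs q)" "rs True + rs False \<le> s"
      "\<And>q z. g (emb q z) = emb (q = p) (gs q z)" unfolding s_def using reach_sections by blast
    have "g z = glue p (gs True) (gs False) z" for z
    proof (cases z rule: emb_cases)
      case (1 q z')
      then show ?thesis by (cases q) (simp_all add: gs(3) glue_emb)
    qed
    then have eq: "g = glue p (gs True) (gs False)" by auto
    \<comment> \<open>Rounding the first weight down leaves at most \<open>s - real k\<close> for
      the second, so finitely many pairs of radii suffice.\<close>
    define k where "k = nat \<lfloor>rs True\<rfloor>"
    have nn: "0 \<le> rs True" "0 \<le> rs False" using gs(1) reach_nonneg by blast+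
    have k: "real k \<le> rs True" "rs True \<le> real k + 1" using nn unfolding k_def by linarith+
    have "gs True \<in> ?B (real k + 1)" using gs(1)[of True] k reach_mono by blast
    moreover have "gs False \<in> ?B (s - real k)"
      using gs(1)[of False] gs(2) k by (auto intro: reach_mono)
    moreover have "k \<le> nat \<lfloor>s\<rfloor>" unfolding k_def using gs(2) nn by (intro nat_mono floor_mono) simp
    ultimately have "(gs True, gs False) \<in> ?P" by blast
    then show "g \<in> (\<lambda>(p, g, h). glue p g h) ` (UNIV \<times> ?P)" unfolding eq by (auto intro!: image_eqI)
  qed
  have fin: "finite (UNIV \<times> ?P :: (bool \<times> _) set)" using reach_finite by auto
  have "card {g. reach (Suc n) r g} \<le> card (UNIV \<times> ?P :: (bool \<times> _) set)"
    using fin sub by (rule surj_card_le)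
  also have "\<dots> = 2 * card ?P" by (simp add: card_cartesian_product)
  also have "card ?P \<le> (\<Sum>k\<le>nat \<lfloor>s\<rfloor>. card (?B (real k + 1) \<times> ?B (s - real k)))"
    by (rule card_UN_le) simp
  finally have "card {g. reach (Suc n) r g} \<le>
      2 * (\<Sum>k\<le>nat \<lfloor>s\<rfloor>. card (?B (real k + 1) \<times> ?B (s - real k)))"
    by (simp only: mult_le_mono order_refl)
  then have "real (card {g. reach (Suc n) r g}) \<le>
      real (2 * (\<Sum>k\<le>nat \<lfloor>s\<rfloor>. card (?B (real k + 1) \<times> ?B (s - real k))))"
    by (simp only: of_nat_le_iff)
  then show ?thesis by (simp add: card_cartesian_product s_def)
qed

lemma reach_card_bound:
  "\<exists>K>0. \<forall>n r. r \<le> real n \<longrightarrow> real (card {g. reach n r g}) \<le> exp (K * (max r 1) powr alpha)"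
proof (rule recursive_growth_bound[where \<eta> = eta and A = wA])
  fix \<rho> :: real
  obtain j where j: "\<And>n r. r \<le> \<rho> \<Longrightarrow> {g. reach n r g} \<subseteq> layer n j" using reach_subset_layer by blast
  have "real (card {g. reach n r g}) \<le> real ((4 * 2 ^ card {x. \<beta> x \<noteq> id} + 1) ^ (j + 1))"
    if "r \<le> \<rho>" for n r
    using card_mono[OF layer_card(1) j[OF that]] layer_card(2)[of n j] by (meson le_trans of_nat_mono)
  then show "\<exists>C. \<forall>n. \<forall>r\<le>\<rho>. real (card {g. reach n r g}) \<le> C" by blast
qed (use alpha_props(1) alpha_less_1 eta_bounds eta_alpha wA_pos reach_card_step in auto)

text \<open>All weights are at most 1, so word length dominates weighted length.\<close>

lemma foldr_reach:
  assumes "set ws \<subseteq> insert Aact (letters n)"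
  shows "reach n (real (length ws)) (foldr (\<circ>) ws id)"
  using assms
proof (induction ws)
  case (Cons w ws)
  have IH: "reach n (real (length ws)) (foldr (\<circ>) ws id)" using Cons.prems by (intro Cons.IH) simp
  have e: "foldr (\<circ>) (w # ws) id = w \<circ> foldr (\<circ>) ws id" by (simp only: foldr.simps o_apply)
  consider "w = Aact" | k T where "w = letter n k T" using Cons.prems by (auto simp: letters_def)
  then show ?case
  proof cases
    case 1
    show ?thesis unfolding e unfolding 1
      by (rule reach_mono[OF reach_A[OF IH]]) (use wA_le_1 in simp)
  next
    case 2
    show ?thesis unfolding e unfolding 2
      by (rule reach_mono[OF reach_letter[OF IH, of k T]]) (use wt_le_1[of k "letter n k T"] in simp)
  qed
qed (simp add: reach_id)

end

section \<open>Growth functions and growth rates\<close>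

text \<open>Fekete's lemma: the limit is the infimum of the quotients. Monotonicity allows rounding
  \<open>n\<close> up to a multiple of \<open>m\<close>.\<close>

lemma subadditive_quotient_limit:
  fixes u :: "nat \<Rightarrow> real"
  assumes sub: "\<And>m n. u (m + n) \<le> u m + u n" and mono: "\<And>m n. m \<le> n \<Longrightarrow> u m \<le> u n"
    and nonneg: "\<And>n. 0 \<le> u n"
  shows "\<exists>L. (\<lambda>n. u n / real n) \<longlonglongrightarrow> L \<and> 0 \<le> L \<and> (\<forall>m>0. L \<le> u m / real m)"
proof -
  define L where "L = (INF m\<in>{0<..}. u m / real m)"
  have bdd: "bdd_below ((\<lambda>m. u m / real m) ` {0<..})"
    by (rule bdd_belowI2[of _ 0]) (simp add: nonneg)
  have L_le: "L \<le> u m / real m" if "m > 0" for m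
    unfolding L_def using that by (intro cINF_lower[OF bdd]) simp
  have L0: "0 \<le> L" unfolding L_def by (rule cINF_greatest) (auto simp: nonneg)
  have mult: "u (Suc k * m) \<le> real (Suc k) * u m" for k m
  proof (induction k)
    case (Suc k)
    have "u (Suc (Suc k) * m) \<le> u m + u (Suc k * m)" using sub[of m "Suc k * m"] by simp
    then show ?case using Suc by (simp add: algebra_simps)
  qed simp
  have upper: "u n / real n \<le> u m / real m + u m / real n" if "m > 0" "n > 0" for m n
  proof -
    have "n \<le> Suc (n div m) * m"
      using that div_mult_mod_eq[of n m] mod_less_divisor[of m n] unfolding mult_Suc by linarith
    then have "u n \<le> real (Suc (n div m)) * u m" using mono mult order_trans by blast
    also have "\<dots> \<le> (real n / real m + 1) * u m"
    proof (rule mult_right_mono)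
      have "real (n div m * m) \<le> real n" by (simp only: of_nat_le_iff div_times_less_eq_dividend)
      then show "real (Suc (n div m)) \<le> real n / real m + 1"
        using that by (simp add: pos_le_divide_eq)
    qed (rule nonneg)
    finally have "u n \<le> (real n / real m + 1) * u m" .
    then have "u n / real n \<le> (real n / real m + 1) * u m / real n" by (intro divide_right_mono) simp_all
    also have "\<dots> = u m / real m + u m / real n" using that by (simp add: field_simps)
    finally show ?thesis .
  qed
  have "(\<lambda>n. u n / real n) \<longlonglongrightarrow> L"
  proof (rule order_tendstoI)
    fix y assume "y < L"
    show "\<forall>\<^sub>F n in sequentially. y < u n / real n"
      using eventually_gt_at_top[of 0]
      by eventually_elim (rule less_le_trans[OF \<open>y < L\<close> L_le])
  next
    fix y assume "L < y"
    then obtain m where m: "m > 0" "u m / real m < y"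
      unfolding L_def using cINF_less_iff[OF _ bdd] by auto
    have "(\<lambda>n. u m / real m + u m / real n) \<longlonglongrightarrow> u m / real m + 0"
      by (intro tendsto_intros lim_const_over_n)
    then have "\<forall>\<^sub>F n in sequentially. u m / real m + u m / real n < y"
      using m(2) by (intro order_tendstoD) auto
    then show "\<forall>\<^sub>F n in sequentially. u n / real n < y"
      using eventually_gt_at_top[of 0] by eventually_elim (rule le_less_trans[OF upper[OF m(1)]])
  qed
  then show ?thesis using L_le L0 by blast
qed

context group begin

lemma gens_in_carrier: "S \<subseteq> carrier G \<Longrightarrow> S \<union> m_inv G ` S \<subseteq> carrier G"
  by auto

lemma word_value_Nil [simp]: "word_value G [] = \<one>"
  and word_value_Cons [simp]: "word_value G (x # xs) = x \<otimes> word_value G xs"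
  by (simp_all add: word_value_def)

lemma word_value_closed: "set ws \<subseteq> carrier G \<Longrightarrow> word_value G ws \<in> carrier G"
  by (induction ws) auto

lemma word_value_append:
  "set us \<subseteq> carrier G \<Longrightarrow> set vs \<subseteq> carrier G \<Longrightarrow>
    word_value G (us @ vs) = word_value G us \<otimes> word_value G vs"
  by (induction us) (auto simp: m_assoc word_value_closed)

lemma growth_ball_closed: "S \<subseteq> carrier G \<Longrightarrow> growth_ball G S r \<subseteq> carrier G"
  using word_value_closed[OF order_trans[OF _ gens_in_carrier]] by (auto simp: growth_ball_def)

lemma growth_ball_finite:
  assumes "finite S" shows "finite (growth_ball G S r)"
proof -
  have "growth_ball G S r = word_value G ` {ws. set ws \<subseteq> S \<union> m_inv G ` S \<and> length ws \<le> r}"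
    unfolding growth_ball_def by auto
  then show ?thesis using assms by (simp add: finite_lists_length_le)
qed

lemma growth_ball_mono: "m \<le> n \<Longrightarrow> growth_ball G S m \<subseteq> growth_ball G S n"
  unfolding growth_ball_def by force

lemma growth_ball_one: "\<one> \<in> growth_ball G S r"
  unfolding growth_ball_def by (auto intro!: exI[of _ "[]"])

lemma growth_ball_mult:
  assumes "S \<subseteq> carrier G" "x \<in> growth_ball G S m" "y \<in> growth_ball G S n"
  shows "x \<otimes> y \<in> growth_ball G S (m + n)"
proof -
  obtain us vs where *: "x = word_value G us" "y = word_value G vs" "set us \<subseteq> S \<union> m_inv G ` S"
    "set vs \<subseteq> S \<union> m_inv G ` S" "length us \<le> m" "length vs \<le> n"
    using assms unfolding growth_ball_def by auto
  have "x \<otimes> y = word_value G (us @ vs)"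
    unfolding * using gens_in_carrier[OF assms(1)] * by (intro word_value_append[symmetric]) blast+
  then show ?thesis unfolding growth_ball_def using * by (auto intro!: exI[of _ "us @ vs"])
qed

lemma growth_ball_add:
  assumes "S \<subseteq> carrier G"
  shows "growth_ball G S (m + n) \<subseteq> (\<lambda>(x, y). x \<otimes> y) ` (growth_ball G S m \<times> growth_ball G S n)"
proof
  fix g assume "g \<in> growth_ball G S (m + n)"
  then obtain ws where ws: "g = word_value G ws" "set ws \<subseteq> S \<union> m_inv G ` S" "length ws \<le> m + n"
    unfolding growth_ball_def by auto
  let ?u = "take m ws" and ?v = "drop m ws"
  have sub: "set ?u \<subseteq> S \<union> m_inv G ` S" "set ?v \<subseteq> S \<union> m_inv G ` S"
    using ws(2) set_take_subset set_drop_subset by fast+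
  have "g = word_value G ?u \<otimes> word_value G ?v"
    using word_value_append[of ?u ?v] sub gens_in_carrier[OF assms] ws(1) by (metis append_take_drop_id subset_trans)
  moreover have "word_value G ?u \<in> growth_ball G S m" "word_value G ?v \<in> growth_ball G S n"
    using sub ws(3) unfolding growth_ball_def by fastforce+
  ultimately show "g \<in> (\<lambda>(x, y). x \<otimes> y) ` (growth_ball G S m \<times> growth_ball G S n)" by force
qed

context
  fixes S assumes S: "finite S" "S \<subseteq> carrier G"
begin

lemma growth_function_ge_1: "1 \<le> growth_function G S r"
  using card_mono[OF growth_ball_finite[OF S(1)], of "{\<one>}" r] growth_ball_one
  by (simp add: growth_function_def)

lemma growth_function_mono: "m \<le> n \<Longrightarrow> growth_function G S m \<le> growth_function G S n"
  unfolding growth_function_def by (intro card_mono growth_ball_finite S growth_ball_mono)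

lemma growth_function_add: "growth_function G S (m + n) \<le> growth_function G S m * growth_function G S n"
  using surj_card_le[OF _ growth_ball_add[OF S(2)], of m n] growth_ball_finite[OF S(1)]
  unfolding growth_function_def by (simp add: card_cartesian_product)

text \<open>Fekete's lemma for the logarithm of the growth function. Convergence gives the
  \<open>lim\<close> in \<open>growth_rate\<close> its meaning, and each single radius bounds the
  rate from above.\<close>

lemma growth_rate_limit:
  shows "(\<lambda>r. root r (real (growth_function G S r))) \<longlonglongrightarrow> growth_rate G S"
    and "1 \<le> growth_rate G S"
    and "\<And>m. 0 < m \<Longrightarrow> growth_rate G S \<le> exp (ln (real (growth_function G S m)) / real m)"
proof -
  let ?v = "\<lambda>r. real (growth_function G S r)"
  have v: "1 \<le> ?v r" for r using growth_function_ge_1 by simp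
  have pos: "0 < ?v r" for r using v[of r] by linarith
  have "ln (?v (m + n)) \<le> ln (?v m) + ln (?v n)" for m n
  proof -
    have "?v (m + n) \<le> ?v m * ?v n" using growth_function_add[of m n] by (metis of_nat_le_iff of_nat_mult)
    then have "ln (?v (m + n)) \<le> ln (?v m * ?v n)" using pos by simp
    then show ?thesis using pos by (simp add: ln_mult_pos)
  qed
  moreover have "ln (?v m) \<le> ln (?v n)" if "m \<le> n" for m n
    using growth_function_mono[OF that] pos by simp
  moreover have "0 \<le> ln (?v n)" for n using v by simp
  ultimately obtain L where L: "(\<lambda>n. ln (?v n) / real n) \<longlonglongrightarrow> L" "0 \<le> L"
      "\<And>m. m > 0 \<Longrightarrow> L \<le> ln (?v m) / real m"
    using subadditive_quotient_limit[of "\<lambda>n. ln (?v n)"] by blast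
  have "(\<lambda>n. exp (ln (?v n) / real n)) \<longlonglongrightarrow> exp L" by (intro tendsto_intros L)
  moreover have "\<forall>\<^sub>F n in sequentially. exp (ln (?v n) / real n) = root n (?v n)"
    using eventually_gt_at_top[of 0]
    by eventually_elim (use pos in \<open>simp add: root_powr_inverse powr_def\<close>)
  ultimately have lim: "(\<lambda>n. root n (?v n)) \<longlonglongrightarrow> exp L" by (rule Lim_transform_eventually)
  then have eq: "growth_rate G S = exp L" unfolding growth_rate_def by (rule limI)
  show "(\<lambda>r. root r (?v r)) \<longlonglongrightarrow> growth_rate G S" using lim eq by simp
  show "1 \<le> growth_rate G S" using eq L(2) by simp
  show "growth_rate G S \<le> exp (ln (?v m) / real m)" if "0 < m" for m using eq L(3)[OF that] by simp
qed

lemma growth_rate_gt_1: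
  assumes c: "c > 0" and ge: "\<And>n. 2 ^ n \<le> growth_function G S (c * n)"
  shows "growth_rate G S > 1"
proof -
  have "strict_mono (\<lambda>n. c * n)" using c by (simp add: strict_mono_def)
  then have lim: "(\<lambda>n. root (c * n) (real (growth_function G S (c * n)))) \<longlonglongrightarrow> growth_rate G S"
    using LIMSEQ_subseq_LIMSEQ[OF growth_rate_limit(1)] unfolding comp_def by blast
  have "root c 2 \<le> root (c * n) (real (growth_function G S (c * n)))" if "n \<ge> 1" for n
  proof -
    have "(2::real) ^ n \<le> real (growth_function G S (c * n))" using ge[of n] by (metis of_nat_le_iff of_nat_numeral of_nat_power)
    then have "root (c * n) (2 ^ n) \<le> root (c * n) (real (growth_function G S (c * n)))"
      using c that by (intro real_root_le_mono) auto
    moreover have "root (c * n) (2 ^ n) = root c 2"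
      using that by (simp add: real_root_mult_exp real_root_power_cancel)
    ultimately show ?thesis by simp
  qed
  then have "root c 2 \<le> growth_rate G S" by (intro LIMSEQ_le_const[OF lim]) blast
  moreover have "root c 2 > 1" using c by simp
  ultimately show ?thesis by linarith
qed

end

text \<open>A generating set that is good up to radius \<open>r\<close> has rate at most
  \<open>exp (K * real r powr (a - 1))\<close>, which tends to 1 as \<open>a < 1\<close>.\<close>

lemma nonuniform_exponential_growthI:
  assumes S: "finite_generating_set G S" "growth_rate G S > 1"
    and a: "a < 1" and bound: "\<And>R::real. R > 0 \<Longrightarrow> \<exists>S. finite_generating_set G S \<and>
        (\<forall>r::nat. real r \<le> R \<longrightarrow> real (growth_function G S r) \<le> exp (K * real r powr a))"
  shows "nonuniform_exponential_growth G"
proof -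
  let ?I = "INF S\<in>{S. finite_generating_set G S}. growth_rate G S"
  have "?I \<le> exp (K * real r powr (a - 1))" if "r > 0" for r :: nat
  proof -
    have "0 < real r" using that by simp
    then obtain T where T: "finite_generating_set G T"
      "real (growth_function G T r) \<le> exp (K * real r powr a)" using bound[of "real r"] by blast
    have T': "finite T" "T \<subseteq> carrier G" using T(1) by (auto simp: finite_generating_set_def)
    have "?I \<le> growth_rate G T"
      using T(1) growth_rate_limit(2)
      by (intro cINF_lower bdd_belowI2[of _ 1]) (auto simp: finite_generating_set_def)
    also have "\<dots> \<le> exp (ln (real (growth_function G T r)) / real r)"
      using growth_rate_limit(3)[OF T' that] .
    also have "\<dots> \<le> exp (K * real r powr a / real r)"
    proof -
      have "0 < real (growth_function G T r)" using growth_function_ge_1[OF T', of r] by simp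
      then have "ln (real (growth_function G T r)) \<le> ln (exp (K * real r powr a))"
        using T(2) by (subst ln_le_cancel_iff) simp_all
      then show ?thesis by (simp add: divide_right_mono)
    qed
    also have "K * real r powr a / real r = K * real r powr (a - 1)" using that by (simp add: powr_diff)
    finally show ?thesis .
  qed
  moreover have "(\<lambda>r. exp (K * real r powr (a - 1))) \<longlonglongrightarrow> exp (K * 0)"
    using a by (intro tendsto_intros tendsto_neg_powr filterlim_real_sequentially) auto
  ultimately have "?I \<le> exp (K * 0)" by (intro LIMSEQ_le_const[rotated]) (auto intro!: exI[of _ 1])
  then show ?thesis using S
    unfolding nonuniform_exponential_growth_def exponential_growth_def uniform_exponential_growth_def by auto
qed

end

section \<open>Isomorphism invariance, and exponential growth from positive words\<close>

lemma iso_transfer_generating_set: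
  assumes G: "group G" and H: "group H" and h: "h \<in> iso G H" and S: "finite_generating_set G S"
  shows "finite_generating_set H (h ` S)" "growth_function H (h ` S) r = growth_function G S r"
proof -
  interpret group_hom G H h
    using assms by (simp add: group_hom_def group_hom_axioms_def iso_def)
  have S': "finite S" "S \<subseteq> carrier G" "generate G S = carrier G"
    using S by (auto simp: finite_generating_set_def)
  have bij: "bij_betw h (carrier G) (carrier H)" using h by (simp add: iso_def)
  show "finite_generating_set H (h ` S)"
    unfolding finite_generating_set_def using S' generate_img[OF S'(2)] bij
    by (auto simp: bij_betw_def)
  have wv: "word_value H (map h ws) = h (word_value G ws)" if "set ws \<subseteq> carrier G" for ws
    using that by (induction ws) (auto simp: word_value_def G.word_value_closed[unfolded word_value_def])
  have img: "h ` S \<union> m_inv H ` h ` S = h ` (S \<union> m_inv G ` S)"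
    using S'(2) by (force simp: image_Un image_image)
  have "growth_ball H (h ` S) r = h ` growth_ball G S r"
  proof
    show "h ` growth_ball G S r \<subseteq> growth_ball H (h ` S) r"
    proof
      fix y assume "y \<in> h ` growth_ball G S r"
      then obtain ws where ws: "y = h (word_value G ws)" "set ws \<subseteq> S \<union> m_inv G ` S" "length ws \<le> r"
        unfolding growth_ball_def by auto
      have "set ws \<subseteq> carrier G" using ws(2) G.gens_in_carrier[OF S'(2)] by blast
      then have "y = word_value H (map h ws)" using ws(1) wv by simp
      moreover have "set (map h ws) \<subseteq> h ` (S \<union> m_inv G ` S)" using ws(2) by auto
      ultimately show "y \<in> growth_ball H (h ` S) r"
        unfolding growth_ball_def img using ws(3) by (auto intro!: exI[of _ "map h ws"])
    qed
    show "growth_ball H (h ` S) r \<subseteq> h ` growth_ball G S r"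
    proof
      fix y assume "y \<in> growth_ball H (h ` S) r"
      then obtain vs where vs: "y = word_value H vs" "set vs \<subseteq> h ` (S \<union> m_inv G ` S)" "length vs \<le> r"
        unfolding growth_ball_def img by auto
      have "vs \<in> lists (h ` (S \<union> m_inv G ` S))" using vs(2) by auto
      then obtain ws where ws: "vs = map h ws" "set ws \<subseteq> S \<union> m_inv G ` S"
        unfolding lists_image by auto
      then have "set ws \<subseteq> carrier G" using G.gens_in_carrier[OF S'(2)] by blast
      then have "y = h (word_value G ws)" using vs(1) ws(1) wv by simp
      then show "y \<in> h ` growth_ball G S r"
        unfolding growth_ball_def using ws vs(3) by auto
    qed
  qed
  moreover have "inj_on h (growth_ball G S r)"
    using bij G.growth_ball_closed[OF S'(2)] by (meson bij_betw_def inj_on_subset)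
  ultimately show "growth_function H (h ` S) r = growth_function G S r"
    unfolding growth_function_def by (simp add: card_image)
qed

lemma (in group) generate_in_growth_ball:
  assumes S: "S \<subseteq> carrier G" and x: "x \<in> generate G S"
  shows "\<exists>c. x \<in> growth_ball G S c"
  using x
proof (induction rule: generate.induct)
  case one
  then show ?case using growth_ball_one by blast
next
  case (incl h)
  then have "h \<in> growth_ball G S 1"
    unfolding growth_ball_def using S by (auto intro!: exI[of _ "[h]"])
  then show ?case by blast
next
  case (inv h)
  then have "inv h \<in> growth_ball G S 1"
    unfolding growth_ball_def using S by (auto intro!: exI[of _ "[inv h]"])
  then show ?case by blast
next
  case (eng g h)
  then show ?case using growth_ball_mult[OF S] by blast
qed

lemma (in group) growth_rate_gt_1_if_free_pair:
  assumes S: "finite_generating_set G S" and xy: "x \<in> carrier G" "y \<in> carrier G"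
    and inj: "\<And>us vs. length us = length vs \<Longrightarrow>
      word_value G (map (\<lambda>b. if b then x else y) us) = word_value G (map (\<lambda>b. if b then x else y) vs) \<Longrightarrow> us = vs"
  shows "growth_rate G S > 1"
proof -
  have S': "finite S" "S \<subseteq> carrier G" "generate G S = carrier G"
    using S by (auto simp: finite_generating_set_def)
  obtain c d where cd: "x \<in> growth_ball G S c" "y \<in> growth_ball G S d"
    using generate_in_growth_ball[OF S'(2)] xy unfolding S'(3) by blast
  \<comment> \<open>The successor makes the radius positive, as \<open>growth_rate_gt_1\<close>
    demands.\<close>
  define e where "e = Suc (max c d)"
  have "c \<le> e" "d \<le> e" by (simp_all add: e_def)
  then have e: "x \<in> growth_ball G S e" "y \<in> growth_ball G S e"
    using cd growth_ball_mono by blast+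
  let ?w = "\<lambda>bs. word_value G (map (\<lambda>b. if b then x else y) bs)"
  have ball: "?w bs \<in> growth_ball G S (e * length bs)" for bs
  proof (induction bs)
    case (Cons b bs)
    have "(if b then x else y) \<otimes> ?w bs \<in> growth_ball G S (e + e * length bs)"
      using e Cons by (intro growth_ball_mult S') auto
    then show ?case by simp
  qed (simp add: growth_ball_one)
  have "2 ^ n \<le> growth_function G S (e * n)" for n
  proof -
    let ?L = "{bs :: bool list. set bs \<subseteq> UNIV \<and> length bs = n}"
    have "card ?L = 2 ^ n" by (subst card_lists_length_eq) simp_all
    moreover have "inj_on ?w ?L" by (intro inj_onI inj) auto
    then have "card ?L \<le> card (growth_ball G S (e * n))"
      using ball by (intro card_inj_on_le growth_ball_finite S') auto
    ultimately show ?thesis by (simp add: growth_function_def)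
  qed
  then show ?thesis by (intro growth_rate_gt_1[OF S'(1,2), of e]) (simp_all add: e_def)
qed

section \<open>Embedding into a group generated by involutions\<close>

definition perms :: "('x \<Rightarrow> 'x) monoid" where
  "perms = \<lparr>carrier = {f. bij f}, monoid.mult = (\<circ>), one = id\<rparr>"

lemma perms_simps [simp]: "carrier perms = {f. bij f}" "monoid.mult perms = (\<circ>)" "one perms = id"
  by (simp_all add: perms_def)

interpretation perms: group perms
proof (rule groupI)
  fix f :: "'a \<Rightarrow> 'a" assume "f \<in> carrier perms"
  then have "bij f" by simp
  then have "bij (inv_into UNIV f)" "inv_into UNIV f \<circ> f = id"
    by (simp_all add: bij_imp_bij_inv bij_is_inj)
  then show "\<exists>g\<in>carrier perms. g \<otimes>\<^bsub>perms\<^esub> f = \<one>\<^bsub>perms\<^esub>"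
    by (intro bexI[of _ "inv_into UNIV f"]) simp_all
qed (auto intro: bij_comp)

definition involutive :: "('x \<Rightarrow> 'x) \<Rightarrow> bool" where
  "involutive f \<longleftrightarrow> (\<forall>x. f (f x) = x)"

lemma involutive_bij: "involutive f \<Longrightarrow> bij f"
  unfolding involutive_def by (rule o_bij[of f f]) auto

lemma involutive_perms_inv: "involutive f \<Longrightarrow> m_inv perms f = f"
  by (rule perms.inv_equality) (auto simp: involutive_bij, auto simp: involutive_def)

lemma perms_generate_comp: "f \<in> generate perms S \<Longrightarrow> g \<in> generate perms S \<Longrightarrow> f \<circ> g \<in> generate perms S"
  using generate.eng[of f perms S g] by simp

lemma generate_subset_generate:
  assumes "S \<subseteq> generate perms T" "\<And>f. f \<in> T \<Longrightarrow> bij f"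
  shows "generate perms S \<subseteq> generate perms T"
  using assms by (intro perms.generate_subgroup_incl perms.generate_is_subgroup) auto

text \<open>Involutions on two copies of \<^typ>\<open>'z \<times> int \<times> int\<close> (the copy is chosen by the Boolean).
  On the first copy they generate translations of the last coordinate, translations of the third
  one in the slice where the last one vanishes, and (through \<^term>\<open>swap_copies \<circ> twisted_swap p\<close>)
  the map acting by \<^term>\<open>p (nat m)\<close> on the half-line \<^term>\<open>n \<ge> 0\<close> of the slice \<^term>\<open>m \<ge> 0\<close>.
  The commutator of suitable conjugates of the last two isolates a single \<^term>\<open>p i\<close>.\<close>

type_synonym 'z site = "bool \<times> 'z \<times> int \<times> int"

fun reflect_slice :: "int \<Rightarrow> 'z site \<Rightarrow> 'z site" where
  "reflect_slice e (c, x, n, m) = (c, x, n, if c then e - m else m)"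

fun reflect_cell :: "int \<Rightarrow> 'z site \<Rightarrow> 'z site" where
  "reflect_cell e (c, x, n, m) = (c, x, if c \<and> m = 0 then e - n else n, m)"

fun swap_copies :: "'z site \<Rightarrow> 'z site" where
  "swap_copies (c, x, n, m) = (\<not> c, x, n, m)"

fun twisted_swap :: "(nat \<Rightarrow> 'z \<Rightarrow> 'z) \<Rightarrow> 'z site \<Rightarrow> 'z site" where
  "twisted_swap p (c, x, n, m) = (\<not> c,
    if 0 \<le> n \<and> 0 \<le> m then (if c then p (nat m) x else inv_into UNIV (p (nat m)) x) else x, n, m)"

definition site_gens :: "(nat \<Rightarrow> 'z \<Rightarrow> 'z) \<Rightarrow> ('z site \<Rightarrow> 'z site) list" where
  "site_gens p = [reflect_slice 0, reflect_slice 1, reflect_cell 0, reflect_cell 1, swap_copies, twisted_swap p]"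

fun shift :: "int \<Rightarrow> 'z site \<Rightarrow> 'z site" where
  "shift j (c, x, n, m) = (c, x, n, if c then m + j else m)"

fun at_origin :: "('z \<Rightarrow> 'z) \<Rightarrow> 'z site \<Rightarrow> 'z site" where
  "at_origin f (c, x, n, m) = (c, if c \<and> n = 0 \<and> m = 0 then f x else x, n, m)"

lemma site_gens_involutive:
  assumes "\<And>i. bij (p i)" "g \<in> set (site_gens p)"
  shows "involutive g"
proof -
  have "p i (inv_into UNIV (p i) x) = x" "inv_into UNIV (p i) (p i x) = x" for i x
    using assms(1)[of i] by (simp_all add: bij_is_surj surj_f_inv_f bij_is_inj inv_f_f)
  then show ?thesis using assms(2) unfolding site_gens_def involutive_def by auto
qed

text \<open>Two reflections whose parameters differ by 1 compose to a unit translation, as in the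
  infinite dihedral group.\<close>

lemma shift_generated: "shift (int j) \<in> generate perms (set (site_gens p))"
  "shift (- int j) \<in> generate perms (set (site_gens p))"
proof -
  let ?G = "generate perms (set (site_gens p))"
  have r: "reflect_slice 0 \<in> ?G" "reflect_slice 1 \<in> ?G"
    by (auto simp: site_gens_def intro: generate.incl)
  have 0: "shift 0 = (id :: 'a site \<Rightarrow> 'a site)" by (simp add: fun_eq_iff)
  have plus: "shift (int (Suc j)) = (reflect_slice 1 \<circ> reflect_slice 0) \<circ> (shift (int j) :: 'a site \<Rightarrow> 'a site)"
    and minus: "shift (- int (Suc j)) = (reflect_slice 0 \<circ> reflect_slice 1) \<circ> (shift (- int j) :: 'a site \<Rightarrow> 'a site)" for j
    by (auto simp: fun_eq_iff)
  have id: "id \<in> ?G" using generate.one[of perms "set (site_gens p)"] by simp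
  show "shift (int j) \<in> ?G"
  proof (induction j)
    case (Suc j)
    then show ?case unfolding plus by (intro perms_generate_comp r)
  qed (use id 0 in \<open>simp only: of_nat_0\<close>)
  show "shift (- int j) \<in> ?G"
  proof (induction j)
    case (Suc j)
    then show ?case unfolding minus by (intro perms_generate_comp r)
  qed (use id 0 in \<open>simp only: of_nat_0 minus_zero\<close>)
qed

text \<open>Conjugation by \<open>shift\<close> brings slice \<open>i\<close> to slice 0. The
  commutator with the unit translation of that slice compares the half-lines from 0 and from 1, so
  \<open>p i\<close> survives in the cell 0 only; in other slices and on the second copy everything
  cancels.\<close>

lemma at_origin_generated:
  assumes p: "\<And>i. bij (p i)"
  shows "at_origin (p i) \<in> generate perms (set (site_gens p))"
proof -
  let ?G = "generate perms (set (site_gens p))"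
  let ?j = "int i"
  let ?c = "(shift (- ?j) \<circ> (swap_copies \<circ> twisted_swap p) \<circ> shift ?j) \<circ> (reflect_cell 1 \<circ> reflect_cell 0)"
  let ?d = "(shift (- ?j) \<circ> (twisted_swap p \<circ> swap_copies) \<circ> shift ?j) \<circ> (reflect_cell 0 \<circ> reflect_cell 1)"
  have pinv: "p i (inv_into UNIV (p i) x) = x" "inv_into UNIV (p i) (p i x) = x" for i x
    using p[of i] by (simp_all add: bij_is_surj surj_f_inv_f bij_is_inj inv_f_f)
  have "?c \<circ> ?d = at_origin (p i)"
  proof
    fix z :: "'a site"
    obtain c x n m where z: "z = (c, x, n, m)" by (cases z) auto
    show "(?c \<circ> ?d) z = at_origin (p i) z"
      unfolding z by (cases c; cases "m = 0") (auto simp: pinv)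
  qed
  moreover have "?c \<circ> ?d \<in> ?G"
    by (intro perms_generate_comp shift_generated) (auto simp: site_gens_def intro: generate.incl)
  ultimately show ?thesis by simp
qed

lemma at_origin_comp: "at_origin (f \<circ> g) = at_origin f \<circ> at_origin g"
  by (auto simp: fun_eq_iff)

section \<open>The permutational wreath product\<close>

inductive_set grig :: "(nat \<Rightarrow> nat) set" where
  grig_id: "id \<in> grig"
| grig_a: "f \<in> grig \<Longrightarrow> aact \<circ> f \<in> grig"
| grig_v: "f \<in> grig \<Longrightarrow> vact k \<circ> f \<in> grig"

text \<open>Below the digit 1, aba acts as a, and each of b, c, d is the section of another one
  because \<open>nxt\<close> permutes them.\<close>

lemma grig_section:
  assumes "f \<in> grig" shows "\<exists>h\<in>grig. \<forall>y. h (2 * y) = 2 * f y"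
  using assms
proof (induction rule: grig.induct)
  case grig_id
  show ?case by (intro bexI[of _ id]) (auto intro: grig.intros)
next
  case (grig_a f)
  then obtain h where "h \<in> grig" "\<forall>y. h (2 * y) = 2 * f y" by blast
  then show ?case
    by (intro bexI[of _ "aact \<circ> (vact KB \<circ> (aact \<circ> h))"] grig.intros) auto
next
  case (grig_v f k)
  then obtain h where h: "h \<in> grig" "\<forall>y. h (2 * y) = 2 * f y" by blast
  have "\<exists>l. nxt l = k"
    by (rule exI[of _ "nxt (nxt k)"]) (cases k; simp)
  then obtain l where "nxt l = k" by blast
  with h show ?case by (intro bexI[of _ "vact l \<circ> h"] grig.intros) auto
qed

text \<open>Induction on the encoding: if the first digit is 0, a turns it into 1, and
  \<open>grig_section\<close> lifts the element that works for the rest of the ray.\<close>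

lemma grig_transitive: "\<exists>f\<in>grig. f x = 0"
proof (induction x rule: less_induct)
  case (less x)
  show ?case
  proof (cases "x = 0")
    case False
    then obtain f where f: "f \<in> grig" "f (x div 2) = 0" using less[of "x div 2"] by auto
    obtain h where h: "h \<in> grig" "\<And>y. h (2 * y) = 2 * f y" using grig_section[OF f(1)] by blast
    have h0: "h (2 * (x div 2)) = 0" using h f by simp
    show ?thesis
    proof (cases "even x")
      case True
      then show ?thesis using h h0 by auto
    next
      case False
      then have "x = Suc (2 * (x div 2))" by presburger
      then have "aact x = 2 * (x div 2)" by (metis aact_odd)
      then have "(h \<circ> aact) x = 0" using h0 by simp
      moreover have "f \<circ> aact \<in> grig" if "f \<in> grig" for f
        using that
      proof (induction rule: grig.induct)
        case grig_id
        show ?case using grig.grig_a[OF grig.grig_id] by simp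
      qed (simp_all only: comp_assoc grig.intros)
      ultimately show ?thesis using h by blast
    qed
  qed (metis grig.grig_id id_apply)
qed

lemma grig_bij: "f \<in> grig \<Longrightarrow> bij f"
proof (induction rule: grig.induct)
  case grig_id
  show ?case by (rule bij_id)
next
  case (grig_a f)
  have "bij aact" by (rule involutive_bij) (simp add: involutive_def)
  with grig_a show ?case by (intro bij_comp)
next
  case (grig_v f k)
  have "bij (vact k)" by (rule involutive_bij) (simp add: involutive_def)
  with grig_v show ?case by (intro bij_comp)
qed

section \<open>Lamps over the rays, and the generating sets indexed by the depth\<close>

definition on_ray :: "(nat \<Rightarrow> nat) \<Rightarrow> nat \<times> 'w \<Rightarrow> nat \<times> 'w" where
  "on_ray f z = (f (fst z), snd z)"

definition at_ray :: "nat \<Rightarrow> ('w \<Rightarrow> 'w) \<Rightarrow> nat \<times> 'w \<Rightarrow> nat \<times> 'w" where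
  "at_ray x g z = (fst z, if fst z = x then g (snd z) else snd z)"

lemma Aact_on_ray: "Aact = on_ray aact"
  by (simp add: fun_eq_iff Aact_def on_ray_def)

lemma on_ray_comp: "on_ray (f \<circ> g) = on_ray f \<circ> on_ray g"
  by (simp add: fun_eq_iff on_ray_def)

lemma at_ray_comp: "at_ray x (f \<circ> g) = at_ray x f \<circ> at_ray x g"
  by (auto simp: fun_eq_iff at_ray_def)

lemma on_ray_bij: "bij f \<Longrightarrow> bij (on_ray f)"
  by (rule o_bij[of "on_ray (inv_into UNIV f)"])
     (auto simp: fun_eq_iff on_ray_def bij_is_inj bij_is_surj surj_f_inv_f inv_f_f)

text \<open>Conjugation by \<open>on_ray f\<close> carries a lamp from the ray \<open>x\<close> to
  \<open>f x\<close>.\<close>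

lemma on_ray_at_ray:
  assumes "bij f" shows "on_ray f \<circ> at_ray x g = at_ray (f x) g \<circ> on_ray f"
  using bij_is_inj[OF assms] by (auto simp: fun_eq_iff on_ray_def at_ray_def inj_eq)

lemma at_ray_involutive: "involutive g \<Longrightarrow> involutive (at_ray x g)"
  by (auto simp: involutive_def at_ray_def)

text \<open>The involution \<open>\<beta>\<^sub>i\<close> is allowed on the whole orbit \<open>{2\<^sup>i, 3 \<cdot> 2\<^sup>i}\<close> of \<open>2\<^sup>i\<close> under \<open>\<langle>b, c, d\<rangle>\<close>,
  which makes the decorated letters closed under composition.\<close>

fun place :: "('w \<Rightarrow> 'w) list \<Rightarrow> nat \<Rightarrow> 'w \<Rightarrow> 'w" where
  "place [] x = id"
| "place (g # gs) x = (if even x then place gs (x div 2) else if x = 1 \<or> x = 3 then g else id)"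

lemma place_vact: "place gs (vact k x) = place gs x"
proof (induction gs arbitrary: k x)
  case (Cons g gs)
  show ?case
  proof (cases "even x")
    case True
    then obtain y where "x = 2 * y" by auto
    then show ?thesis using Cons by simp
  next
    case False
    then obtain y where y: "x = Suc (2 * y)" by (auto elim: oddE)
    have "aact y = 0 \<or> aact y = 1 \<longleftrightarrow> y = 0 \<or> y = 1"
      unfolding aact_def by presburger
    moreover have "place (g # gs) (Suc (2 * z)) = (if z = 0 \<or> z = 1 then g else id)" for z
    proof -
      have "Suc (2 * z) = 1 \<or> Suc (2 * z) = 3 \<longleftrightarrow> z = 0 \<or> z = 1" by presburger
      then show ?thesis unfolding place.simps by (simp only: if_False even_Suc even_mult_iff even_numeral simp_thms)
    qed
    ultimately show ?thesis unfolding y vact_odd by (cases "flips k") (simp_all only: if_True if_False)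
  qed
qed simp

lemma place_power: "i < length gs \<Longrightarrow> place gs (2 ^ i) = gs ! i"
proof (induction gs arbitrary: i)
  case (Cons g gs)
  then show ?case by (cases i) auto
qed simp

lemma place_involutive: "(\<And>g. g \<in> set gs \<Longrightarrow> involutive g) \<Longrightarrow> involutive (place gs x)"
  by (induction gs arbitrary: x) (auto simp: involutive_def)

lemma place_support: "finite {x. place gs x \<noteq> id}"
proof (induction gs)
  case (Cons g gs)
  have "{x. place (g # gs) x \<noteq> id} \<subseteq> {1, 3} \<union> (\<lambda>x. 2 * x) ` {x. place gs x \<noteq> id}"
    by (auto split: if_splits elim!: evenE)
  then show ?case using Cons finite_subset by blast
qed simp

definition wr_gens :: "('w \<Rightarrow> 'w) list \<Rightarrow> nat \<Rightarrow> (nat \<times> 'w \<Rightarrow> nat \<times> 'w) set" where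
  "wr_gens gs n = {Aact} \<union> range (\<lambda>k. on_ray (vact k)) \<union> (\<lambda>i. at_ray (2 ^ (n + i)) (gs ! i)) ` {..<length gs}"

definition wr_group :: "('w \<Rightarrow> 'w) list \<Rightarrow> (nat \<times> 'w \<Rightarrow> nat \<times> 'w) monoid" where
  "wr_group gs = perms\<lparr>carrier := generate perms (wr_gens gs 0)\<rparr>"

locale involutions =
  fixes gs :: "('w \<Rightarrow> 'w) list"
  assumes gs_invol: "\<And>g. g \<in> set gs \<Longrightarrow> involutive g"

sublocale involutions \<subseteq> decoration "place gs"
  using place_involutive[of gs] gs_invol place_vact place_support
  by unfold_locales (auto simp: involutive_def)

context involutions begin

lemma wr_gens_finite: "finite (wr_gens gs n)"
  unfolding wr_gens_def by (simp add: UNIV_kind)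

lemma wr_gens_involutive: "f \<in> wr_gens gs n \<Longrightarrow> involutive f"
proof -
  have "involutive (Aact :: nat \<times> 'w \<Rightarrow> _)" "involutive (on_ray (vact k) :: nat \<times> 'w \<Rightarrow> _)" for k
    by (simp_all add: involutive_def on_ray_def)
  moreover have "involutive (at_ray x (gs ! i))" if "i < length gs" for x i
    using that by (intro at_ray_involutive gs_invol nth_mem)
  ultimately show "f \<in> wr_gens gs n \<Longrightarrow> involutive f" unfolding wr_gens_def by auto
qed

lemma wr_gens_bij: "f \<in> wr_gens gs n \<Longrightarrow> bij f"
  using wr_gens_involutive involutive_bij by blast

text \<open>The lamp at \<open>2 ^ (n + i)\<close> is the letter of kind \<open>KI\<close> decorated
  at this one ray, since \<open>decor n\<close> is \<open>gs ! i\<close> there.\<close>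

lemma wr_gens_letters: "wr_gens gs n \<subseteq> insert Aact (letters n)"
proof -
  have "on_ray (vact k) = letter n k {}" for k
    by (simp add: fun_eq_iff on_ray_def letter_def)
  then have "on_ray (vact k) \<in> letters n" for k unfolding letters_def by blast
  moreover have "at_ray (2 ^ (n + i)) (gs ! i) \<in> letters n" if "i < length gs" for i
  proof -
    have "decor n (2 ^ (n + i)) = gs ! i"
    proof (induction n)
      case 0
      show ?case using place_power[OF that] by simp
    qed simp
    then have "at_ray (2 ^ (n + i)) (gs ! i) = letter n KI {2 ^ (n + i)}"
      by (auto simp: fun_eq_iff at_ray_def letter_def)
    then show ?thesis unfolding letters_def by blast
  qed
  ultimately show ?thesis unfolding wr_gens_def by auto
qed

lemma on_ray_generated: "f \<in> grig \<Longrightarrow> on_ray f \<in> generate perms (wr_gens gs n)"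
proof (induction rule: grig.induct)
  case grig_id
  have "on_ray id = (\<one>\<^bsub>perms\<^esub> :: nat \<times> 'w \<Rightarrow> _)" by (simp add: fun_eq_iff on_ray_def)
  then show ?case by (metis generate.one)
next
  case (grig_a f)
  have "on_ray aact \<in> generate perms (wr_gens gs n)"
    by (rule generate.incl) (simp add: wr_gens_def Aact_on_ray)
  then show ?case unfolding on_ray_comp using grig_a by (intro perms_generate_comp)
next
  case (grig_v f k)
  have "on_ray (vact k) \<in> generate perms (wr_gens gs n)"
    by (rule generate.incl) (simp add: wr_gens_def)
  then show ?case unfolding on_ray_comp using grig_v by (intro perms_generate_comp)
qed

lemma at_ray_0_iff:
  assumes "bij g"
  shows "at_ray x g \<in> generate perms (wr_gens gs n) \<longleftrightarrow> at_ray 0 g \<in> generate perms (wr_gens gs n)"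
proof -
  let ?K = "generate perms (wr_gens gs n)"
  interpret K: subgroup ?K perms
    using wr_gens_bij by (intro perms.generate_is_subgroup) auto
  obtain f where f: "f \<in> grig" "f x = 0" using grig_transitive by blast
  let ?f = "on_ray f :: nat \<times> 'w \<Rightarrow> _"
  have fK: "?f \<in> ?K" using on_ray_generated f by blast
  have bf: "bij f" using grig_bij f by blast
  have bg: "at_ray y g \<in> carrier perms" for y
  proof -
    have "at_ray y g \<circ> at_ray y (inv_into UNIV g) = id" "at_ray y (inv_into UNIV g) \<circ> at_ray y g = id"
      using assms by (auto simp: fun_eq_iff at_ray_def bij_is_inj bij_is_surj surj_f_inv_f inv_f_f)
    then have "bij (at_ray y g)" by (intro o_bij)
    then show ?thesis by simp
  qed
  have comm: "?f \<otimes>\<^bsub>perms\<^esub> at_ray x g = at_ray 0 g \<otimes>\<^bsub>perms\<^esub> ?f"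
    using on_ray_at_ray[OF bf, of x g] unfolding f(2) perms_simps .
  have fc: "?f \<in> carrier perms" using on_ray_bij[OF bf] by simp
  have "at_ray x g = m_inv perms ?f \<otimes>\<^bsub>perms\<^esub> (at_ray 0 g \<otimes>\<^bsub>perms\<^esub> ?f)"
    unfolding comm[symmetric] using fc bg
    by (metis perms.inv_closed perms.l_inv perms.l_one perms.m_assoc)
  moreover have "at_ray 0 g = (?f \<otimes>\<^bsub>perms\<^esub> at_ray x g) \<otimes>\<^bsub>perms\<^esub> m_inv perms ?f"
    unfolding comm using fc bg by (metis perms.inv_closed perms.r_inv perms.r_one perms.m_assoc)
  ultimately show ?thesis using fK by (metis K.m_closed K.m_inv_closed)
qed

lemma gens_at_ray: "i < length gs \<Longrightarrow> at_ray x (gs ! i) \<in> generate perms (wr_gens gs n)"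
proof -
  assume i: "i < length gs"
  then have "bij (gs ! i)" by (intro involutive_bij gs_invol nth_mem)
  moreover have "at_ray (2 ^ (n + i)) (gs ! i) \<in> generate perms (wr_gens gs n)"
    using i by (intro generate.incl) (auto simp: wr_gens_def)
  ultimately show ?thesis using at_ray_0_iff by blast
qed

text \<open>By transitivity lamps can be conjugated to any ray, so the depth at which they start
  does not change the group.\<close>

lemma wr_generate_eq: "generate perms (wr_gens gs m) = generate perms (wr_gens gs n)"
proof -
  have "generate perms (wr_gens gs m) \<subseteq> generate perms (wr_gens gs n)" for m n
  proof (rule generate_subset_generate)
    have "on_ray (vact k) \<in> generate perms (wr_gens gs n)" "Aact \<in> generate perms (wr_gens gs n)" for k
      by (auto intro!: generate.incl simp: wr_gens_def)
    then show "wr_gens gs m \<subseteq> generate perms (wr_gens gs n)"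
      using gens_at_ray unfolding wr_gens_def[of gs m] by auto
  qed (rule wr_gens_bij)
  then show ?thesis by blast
qed

lemma wr_subgroup: "subgroup (generate perms (wr_gens gs 0)) perms"
  using wr_gens_bij by (intro perms.generate_is_subgroup) auto

lemma wr_group_group: "group (wr_group gs)"
  unfolding wr_group_def by (rule subgroup.subgroup_is_group[OF wr_subgroup perms.group_axioms])

lemma wr_group_simps [simp]: "carrier (wr_group gs) = generate perms (wr_gens gs 0)"
  "monoid.mult (wr_group gs) = (\<circ>)" "\<one>\<^bsub>wr_group gs\<^esub> = id"
  by (simp_all add: wr_group_def)

lemma wr_gens_in_carrier: "wr_gens gs n \<subseteq> generate perms (wr_gens gs 0)"
  using wr_generate_eq[of 0 n] generate.incl[of _ "wr_gens gs n" perms] by blast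

lemma wr_finite_generating_set: "finite_generating_set (wr_group gs) (wr_gens gs n)"
  unfolding finite_generating_set_def
  using wr_gens_finite wr_gens_in_carrier perms.generate_consistent[OF wr_gens_in_carrier wr_subgroup]
    wr_generate_eq[of n 0] by (simp add: wr_group_def)

lemma wr_gens_inv: "f \<in> wr_gens gs n \<Longrightarrow> m_inv (wr_group gs) f = f"
proof -
  assume f: "f \<in> wr_gens gs n"
  have "m_inv (wr_group gs) f = m_inv perms f"
    unfolding wr_group_def using f wr_gens_in_carrier by (intro perms.m_inv_consistent[OF wr_subgroup]) blast
  then show ?thesis using involutive_perms_inv[OF wr_gens_involutive[OF f]] by simp
qed

lemma wr_growth_le: "growth_function (wr_group gs) (wr_gens gs n) r \<le> card {g. reach n (real r) g}"
proof -
  have "growth_ball (wr_group gs) (wr_gens gs n) r \<subseteq> {g. reach n (real r) g}"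
  proof
    fix g assume "g \<in> growth_ball (wr_group gs) (wr_gens gs n) r"
    then obtain ws where ws: "g = word_value (wr_group gs) ws"
      "set ws \<subseteq> wr_gens gs n \<union> m_inv (wr_group gs) ` wr_gens gs n" "length ws \<le> r"
      unfolding growth_ball_def by auto
    have "set ws \<subseteq> wr_gens gs n" using ws(2) wr_gens_inv by force
    then have "set ws \<subseteq> insert Aact (letters n)" using wr_gens_letters by blast
    then have "reach n (real (length ws)) (foldr (\<circ>) ws id)" by (rule foldr_reach)
    moreover have "g = foldr (\<circ>) ws id" unfolding ws(1) word_value_def wr_group_simps ..
    ultimately show "g \<in> {g. reach n (real r) g}" using ws(3) reach_mono by simp
  qed
  then show ?thesis unfolding growth_function_def by (rule card_mono[OF reach_finite])
qed

lemma wr_growth_bound: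
  "\<exists>K. \<forall>R::real. R > 0 \<longrightarrow> (\<exists>S. finite_generating_set (wr_group gs) S \<and>
    (\<forall>r::nat. real r \<le> R \<longrightarrow> real (growth_function (wr_group gs) S r) \<le> exp (K * real r powr alpha)))"
proof -
  interpret W: group "wr_group gs" by (rule wr_group_group)
  obtain K where K: "\<And>n r. r \<le> real n \<Longrightarrow> real (card {g. reach n r g}) \<le> exp (K * (max r 1) powr alpha)"
    using reach_card_bound by blast
  have "real (growth_function (wr_group gs) (wr_gens gs n) r) \<le> exp (K * real r powr alpha)"
    if "r \<le> n" for r n :: nat
  \<comment> \<open>The estimate on \<open>reach\<close> involves \<open>max r 1\<close>, but at
    radius 0 the bound to be met is \<open>exp 0 = 1\<close>.\<close>
  proof (cases "r = 0")
    case True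
    have "growth_ball (wr_group gs) (wr_gens gs n) 0 = {word_value (wr_group gs) []}"
      by (auto simp: growth_ball_def)
    then show ?thesis using True by (simp add: growth_function_def)
  next
    case False
    have "real (growth_function (wr_group gs) (wr_gens gs n) r) \<le> real (card {g. reach n (real r) g})"
      using wr_growth_le by simp
    also have "\<dots> \<le> exp (K * (max (real r) 1) powr alpha)" using that by (intro K) simp
    also have "max (real r) 1 = real r" using False by simp
    finally show ?thesis .
  qed
  moreover have "r \<le> nat \<lceil>R\<rceil>" if "real r \<le> R" for r :: nat and R :: real
    using that by linarith
  ultimately show ?thesis using wr_finite_generating_set by metis
qed

lemma at_ray_generated:
  assumes "g \<in> generate perms (set gs)" shows "at_ray 0 g \<in> generate perms (wr_gens gs 0)"
  using assms
proof (induction rule: generate.induct)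
  case one
  have "at_ray 0 \<one>\<^bsub>perms\<^esub> = (\<one>\<^bsub>perms\<^esub> :: nat \<times> 'w \<Rightarrow> _)" by (simp add: fun_eq_iff at_ray_def)
  then show ?case by (metis generate.one)
next
  case (incl g)
  then show ?case using gens_at_ray by (metis in_set_conv_nth)
next
  case (inv g)
  then show ?case using gens_at_ray involutive_perms_inv gs_invol by (metis in_set_conv_nth)
next
  case (eng f g)
  then show ?case unfolding perms_simps at_ray_comp by (intro perms_generate_comp)
qed

end

section \<open>The regular representation and the final embedding\<close>

definition left_mult :: "('a, 'b) monoid_scheme \<Rightarrow> 'a \<Rightarrow> 'a \<times> bool \<Rightarrow> 'a \<times> bool" where
  "left_mult H h z = (if fst z \<in> carrier H then h \<otimes>\<^bsub>H\<^esub> fst z else fst z, snd z)"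

lemma (in group) left_mult_comp:
  assumes "g \<in> carrier G" "h \<in> carrier G"
  shows "left_mult G (g \<otimes> h) = left_mult G g \<circ> left_mult G h"
  using assms by (auto simp: fun_eq_iff left_mult_def m_assoc)

text \<open>Points outside the carrier are fixed, so this is a permutation of the whole
  type.\<close>

lemma (in group) left_mult_bij:
  assumes "h \<in> carrier G" shows "bij (left_mult G h)"
proof (rule o_bij[of "left_mult G (inv h)"])
  have "left_mult G \<one> = id" by (auto simp: fun_eq_iff left_mult_def)
  then show "left_mult G (inv h) \<circ> left_mult G h = id" "left_mult G h \<circ> left_mult G (inv h) = id"
    using assms by (simp_all flip: left_mult_comp)
qed

text \<open>The Boolean factor only serves to make the nontrivial map at index 0 available, so that the
  resulting group contains a lamplighter group even if \<^term>\<open>H\<close> is trivial.\<close>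

definition enum_perms :: "('a, 'b) monoid_scheme \<Rightarrow> nat \<Rightarrow> 'a \<times> bool \<Rightarrow> 'a \<times> bool" where
  "enum_perms H i = (case i of 0 \<Rightarrow> (\<lambda>z. (fst z, \<not> snd z))
     | Suc j \<Rightarrow> left_mult H (from_nat_into (carrier H) j))"

theorem theorem5:
  fixes H :: "('a, 'b) monoid_scheme"
  assumes "group H" and "countable (carrier H)"
  shows "\<exists>(G :: nat monoid) \<phi>.
    group G \<and> finitely_generated G \<and> \<phi> \<in> mon H G \<and>
    nonuniform_exponential_growth G \<and>
    (\<exists>K::real. \<forall>R::real. R > 0 \<longrightarrow>
      (\<exists>S. finite_generating_set G S \<and>
        (\<forall>r::nat. real r \<le> R \<longrightarrow>
          real (growth_function G S r) \<le> exp (K * real r powr alpha))))"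
proof -
  interpret H: group H by fact
  have ne: "carrier H \<noteq> {}" using H.one_closed by blast
  let ?p = "enum_perms H"
  let ?gs = "site_gens ?p"
  have p_bij: "bij (?p i)" for i
  proof (cases i)
    case 0
    have "involutive (?p 0)" by (simp add: involutive_def enum_perms_def)
    then show ?thesis using 0 involutive_bij by blast
  next
    case (Suc j)
    then show ?thesis using H.left_mult_bij from_nat_into[OF ne] by (simp add: enum_perms_def)
  qed
  interpret involutions ?gs
    by unfold_locales (rule site_gens_involutive[OF p_bij])
  let ?W = "wr_group ?gs"
  interpret W: group ?W by (rule wr_group_group)
  define S0 where "S0 = wr_gens ?gs 0"
  have fgs: "finite_generating_set ?W S0" unfolding S0_def by (rule wr_finite_generating_set)

  define \<phi> where "\<phi> h = at_ray 0 (at_origin (left_mult H h))" for h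
  have \<phi>_closed: "\<phi> h \<in> carrier ?W" if h: "h \<in> carrier H" for h
  proof -
    obtain j where "from_nat_into (carrier H) j = h"
      using from_nat_into_surj[OF assms(2) h] by blast
    then have "left_mult H h = ?p (Suc j)" by (simp add: enum_perms_def)
    then show ?thesis unfolding \<phi>_def wr_group_simps
      using at_ray_generated at_origin_generated[of ?p "Suc j", OF p_bij] by simp
  qed
  have \<phi>_mon: "\<phi> \<in> mon H ?W"
  proof -
    have "\<phi> \<in> hom H ?W"
    proof (rule homI)
      fix g h assume "g \<in> carrier H" "h \<in> carrier H"
      then show "\<phi> (g \<otimes>\<^bsub>H\<^esub> h) = \<phi> g \<otimes>\<^bsub>?W\<^esub> \<phi> h"
        by (simp only: \<phi>_def H.left_mult_comp at_origin_comp at_ray_comp wr_group_simps)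
    qed (rule \<phi>_closed)
    moreover have "inj_on \<phi> (carrier H)"
    proof (rule inj_onI)
      fix g h assume gh: "g \<in> carrier H" "h \<in> carrier H" "\<phi> g = \<phi> h"
      \<comment> \<open>The regular representation is faithful: the image of the identity recovers
        \<open>k\<close>.\<close>
      have "\<phi> k (0, True, (\<one>\<^bsub>H\<^esub>, True), 0, 0) = (0, True, (k, True), 0, 0)" if "k \<in> carrier H" for k
        using that by (simp add: \<phi>_def at_ray_def left_mult_def)
      then show "g = h" using gh by (metis prod.inject)
    qed
    ultimately show ?thesis by (simp add: mon_def)
  qed

  have rate: "growth_rate ?W S0 > 1"
  proof -
    define t :: "nat \<times> ('a \<times> bool) site \<Rightarrow> _" where "t = at_ray 0 (shift 1)"
    define l where "l = at_ray 0 (at_origin (?p 0))"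
    \<comment> \<open>The two lamplighter moves: step by \<open>t\<close>, then optionally flip the
      Boolean at the origin by \<open>l\<close>.\<close>
    define u where "u b = (if b then l \<circ> t else t)" for b
    define w where "w bs = word_value ?W (map u bs)" for bs
    have "t \<in> carrier ?W"
      unfolding t_def using at_ray_generated[OF shift_generated(1)[of 1]] by simp
    moreover have "l \<in> carrier ?W"
      unfolding l_def wr_group_simps by (rule at_ray_generated[OF at_origin_generated[OF p_bij]])
    ultimately have u: "u b \<in> carrier ?W" for b
      unfolding u_def wr_group_simps by (simp add: perms_generate_comp)
    have w_Cons: "w (b # bs) = u b \<otimes>\<^bsub>?W\<^esub> w bs" for b bs
      unfolding w_def by (simp only: list.map W.word_value_Cons)
    have w_Cons': "w (b # bs) z = u b (w bs z)" for b bs z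
      by (simp only: w_Cons wr_group_simps o_apply)
    have w_closed: "w bs \<in> carrier ?W" for bs
      unfolding w_def using u by (intro W.word_value_closed) auto
    have step: "u b (0, True, x, 0, m) = (0, True, if b \<and> m = - 1 then ?p 0 x else x, 0, m + 1)" for b x m
      by (auto simp: u_def l_def t_def at_ray_def)
    have w_site: "w bs (0, True, x, 0, - int k) = (0, True, x, 0, int (length bs) - int k)"
      if "length bs < k" for bs k x
      using that
    proof (induction bs)
      case Nil
      have "w [] = id" by (simp only: w_def list.map W.word_value_Nil wr_group_simps)
      then show ?case by simp
    next
      case (Cons b bs)
      then show ?case unfolding w_Cons' by (simp add: step)
    qed
    have inj: "us = vs" if "length us = length vs" "w us = w vs" for us vs
      using that
    proof (induction us vs rule: list_induct2)
      case (Cons a us b vs)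
      \<comment> \<open>A point started in slice \<open>- int k\<close> enters slice 0 exactly under
        the leftmost letter, so its Boolean reveals that letter, which can then be
        cancelled.\<close>
      define k where "k = Suc (length us)"
      define x where "x = (\<one>\<^bsub>H\<^esub>, True)"
      have *: "w (c # bs) (0, True, x, 0, - int k) = (0, True, if c then ?p 0 x else x, 0, 0)"
        if "length bs = length us" for c bs
      proof -
        have "w bs (0, True, x, 0, - int k) = (0, True, x, 0, - 1)"
          using w_site[of bs k x] that by (simp add: k_def)
        then show ?thesis unfolding w_Cons' by (simp add: step)
      qed
      have "(if a then ?p 0 x else x) = (if b then ?p 0 x else x)"
        using *[of us a] *[of vs b] Cons.hyps Cons.prems by simp
      then have ab: "a = b" by (auto simp: enum_perms_def x_def split: if_splits)
      have "w us = w vs"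
        using Cons.prems W.l_cancel[OF _ w_closed w_closed u] unfolding w_Cons ab by blast
      then show ?case using Cons.IH ab by simp
    qed simp
    have "(\<lambda>b. if b then u True else u False) = u" by (simp add: fun_eq_iff u_def)
    then show ?thesis
      using W.growth_rate_gt_1_if_free_pair[OF fgs u u, of True False] inj unfolding w_def by simp
  qed

  obtain K where K: "\<And>R::real. R > 0 \<Longrightarrow> \<exists>S. finite_generating_set ?W S \<and>
      (\<forall>r::nat. real r \<le> R \<longrightarrow> real (growth_function ?W S r) \<le> exp (K * real r powr alpha))"
    using wr_growth_bound by blast

  \<comment> \<open>A countable union of finite balls; numbering its elements moves the group onto
    natural numbers.\<close>
  have "countable (carrier ?W)"
  proof -
    have "carrier ?W \<subseteq> (\<Union>c. growth_ball ?W S0 c)"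
      using W.generate_in_growth_ball[of S0] fgs by (auto simp: finite_generating_set_def)
    moreover have "countable (\<Union>c. growth_ball ?W S0 c)"
      using W.growth_ball_finite[of S0] fgs by (intro countable_UN) (auto simp: finite_generating_set_def countable_finite)
    ultimately show ?thesis by (rule countable_subset)
  qed
  then have inj: "inj_on (to_nat_on (carrier ?W)) (carrier ?W)" by (rule inj_on_to_nat_on)
  define G where "G = image_group (to_nat_on (carrier ?W)) ?W"
  define e where "e = to_nat_on (carrier ?W)"
  have iso: "e \<in> iso ?W G" unfolding G_def e_def by (rule inj_imp_image_group_iso[OF inj])
  interpret G: group G unfolding G_def by (rule W.inj_imp_image_group_is_group[OF inj])
  note transfer = iso_transfer_generating_set[OF W.group_axioms G.group_axioms iso]

  have bound: "\<exists>S. finite_generating_set G S \<and>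
      (\<forall>r::nat. real r \<le> R \<longrightarrow> real (growth_function G S r) \<le> exp (K * real r powr alpha))"
    if R: "R > 0" for R :: real
  proof -
    obtain S where "finite_generating_set ?W S"
      "\<forall>r::nat. real r \<le> R \<longrightarrow> real (growth_function ?W S r) \<le> exp (K * real r powr alpha)"
      using K[OF R] by blast
    then show ?thesis using transfer by (intro exI[of _ "e ` S"]) simp
  qed
  have "growth_rate G (e ` S0) = growth_rate ?W S0"
    unfolding growth_rate_def transfer(2)[OF fgs] ..
  then have "nonuniform_exponential_growth G"
    using G.nonuniform_exponential_growthI[OF transfer(1)[OF fgs] _ alpha_less_1 bound] rate by simp
  moreover have "finitely_generated G" using transfer(1)[OF fgs] by (auto simp: finitely_generated_def)
  moreover have "e \<circ> \<phi> \<in> mon H G"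
  proof -
    have "inj_on e (\<phi> ` carrier H)"
      using inj \<phi>_closed unfolding e_def by (auto intro: inj_on_subset)
    then show ?thesis using \<phi>_mon iso unfolding mon_def iso_def
      by (auto intro: comp_inj_on hom_compose)
  qed
  ultimately show ?thesis using G.group_axioms bound by blast
qed

end
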